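(* Let $r\ge1$ be an integer, $C=\frac1r$, and let $f_k$ ($k\ge0$) be the power series in $\hbar^2$ defined in the context. Let $u^*,f^*_k,C^*,s^*_k$ be the power series in $\hbar^2$ determined by $$C\,u^*=\sum_{m=0}^\infty f_m\frac{(u^* )^m}{m!}\ \ (u^*=O(\hbar^2)),\quad f_k^*=\sum_{m=0}^\infty f_{k+m}\frac{(u^* )^m}{m!}\ (k\ge1),\quad C^*=C-f_1^*,\quad \exp\Big(-\sum_{i=1}^\infty s_i^*t^i\Big)=1-\sum_{k=1}^\infty\frac{f^*_{k+1}}{C-f_1^*}t^k$$ (these are the coefficients entering the ELSV-type formula for the generalized logarithmic $r$-spin Hurwitz numbers). For a variable $w$ put $$u(w)=\log(1-w)-r\,w,\qquad \partial_u=\frac{w-1}{1+r-r\,w}\,\partial_w,\qquad W(w)=W(w,\hbar)=\frac{1}{\mathcal S(r\hbar\partial_u)}\log(1-w).$$ Then $$u^*=\operatorname{res}_{w=0}u(w)\;d\log(W(w)),\qquad C^*=\operatorname{res}_{w=0}\partial_uW(w)\;d\log(W(w)),$$ and, for $k\ge1$, $$s^*_k=\operatorname{res}_{w=0}\,[\tau^k]\log\left(\frac{\partial_uW(w)}{\frac{\partial_u}{1-\tau\partial_u}W(w)}\right)d\log(W(w)).$$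
   Context: $\mathcal S(u)=u^{-1}(e^{u/2}-e^{-u/2})$, and $[\tau^k]$ extracts the coefficient of $\tau^k$ in the expression to its right; $\frac{\partial_u}{1-\tau\partial_u}=\sum_{i\ge0}\tau^i\partial_u^{i+1}$. All differentials under residues are expanded as formal power series in $\hbar$; each coefficient has a pole of finite order at $w=0$. Definition of $f_k$. On $\mathbb{C}P^1$ with coordinate $z$ let $x(z)=\log z-z^r$, $y(z)=\log(1+z^r)$, $B(z_1,z_2)=\frac{dz_1dz_2}{(z_1-z_2)^2}$, $\partial_x=\frac{d}{dx(z)}$, $\xi_{r,k}(z)=\left(\frac1r\partial_x\right)^k\frac{1}{1-rz^r}$, and $$\Phi(z)=(y(z)-z^r)\,dx(z)+\sum_{a:\,a^r=-1}\operatorname{res}_{\tilde z=a}\Big(\Big(\frac{1}{\mathcal S(\hbar\partial_{x(\tilde z)})}-1\Big)y(\tilde z)\Big)dx(\tilde z)\int^{\tilde z}B(\cdot,z).$$ For meromorphic 1-differentials $\mu,\nu$ with zero residues at the points $q$ with $rq^r=1$, set $\mu*\nu=\sum_{q:\,rq^r=1}\operatorname{res}_{z=q}\mu(z)\int^z\nu(\cdot)$. Then $f_k:=d\xi_{r,k}*\Phi$, a power series in $\hbar^2$ with numerical coefficients, with $f_0|_{\hbar=0}=0$ and $f_1|_{\hbar=0}\neq C$. *)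

theory Defs
  imports "HOL-Complex_Analysis.Complex_Analysis"
begin

text \<open>
  Conventions. Power series in \<open>\<hbar>\<close> are \<open>fps\<close> in the variable \<open>\<hbar>\<close> itself; a power series in
  \<open>\<hbar>\<^sup>2\<close> is one whose odd coefficients vanish. A meromorphic 1-differential \<open>\<mu>(z) dz\<close> is
  represented by the function \<open>\<mu>\<close>; on the \<open>z\<close>-side residues are the analytic \<^const>\<open>residue\<close>.
\<close>

definition S_fps :: "complex fps" where
  "S_fps = (fps_exp (1/2) - fps_exp (-(1/2))) / fps_X"


section \<open>The spectral curve and the series \<open>f\<^sub>k\<close>\<close>

text \<open>
  The functions \<open>x(z) = log z - z^r\<close> and (near the points \<open>a\<^sup>r = -1\<close>) \<open>y(z) = log (1 + z^r)\<close> are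
  multivalued; \<open>dx\<close> and \<open>dy\<close> are single-valued and are taken as the rational functions below, so
  that no branch cut meets a neighbourhood of a point at which a residue is computed. The lemmas
  relate them to the principal branches.
\<close>

definition x_fun :: "nat \<Rightarrow> complex \<Rightarrow> complex" where
  "x_fun r z = Ln z - z ^ r"

definition y_fun :: "nat \<Rightarrow> complex \<Rightarrow> complex" where
  "y_fun r z = Ln (1 + z ^ r)"

definition dx :: "nat \<Rightarrow> complex \<Rightarrow> complex" where
  "dx r z = 1 / z - of_nat r * z ^ (r - 1)"

definition dy :: "nat \<Rightarrow> complex \<Rightarrow> complex" where
  "dy r z = of_nat r * z ^ (r - 1) / (1 + z ^ r)"

lemma x_fun_has_derivative:
  assumes "z \<notin> \<real>\<^sub>\<le>\<^sub>0"
  shows "(x_fun r has_field_derivative dx r z) (at z)"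
  unfolding x_fun_def [abs_def] dx_def
  using assms by (auto intro!: derivative_eq_intros simp: field_simps)

lemma y_fun_has_derivative:
  assumes "1 + z ^ r \<notin> \<real>\<^sub>\<le>\<^sub>0"
  shows "(y_fun r has_field_derivative dy r z) (at z)"
  unfolding y_fun_def [abs_def] dy_def
  using assms by (auto intro!: derivative_eq_intros simp: field_simps)

definition d_dx :: "nat \<Rightarrow> (complex \<Rightarrow> complex) \<Rightarrow> complex \<Rightarrow> complex" where
  "d_dx r F = (\<lambda>z. deriv F z / dx r z)"

text \<open>\<open>\<partial>\<^sub>x\<^sup>n y\<close> for \<open>n \<ge> 1\<close>, with the first derivative given by \<open>dy/dx\<close>.\<close>

definition d_dx_y :: "nat \<Rightarrow> nat \<Rightarrow> complex \<Rightarrow> complex" where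
  "d_dx_y r n = (d_dx r ^^ (n - 1)) (\<lambda>z. dy r z / dx r z)"

definition xi_fun :: "nat \<Rightarrow> nat \<Rightarrow> complex \<Rightarrow> complex" where
  "xi_fun r k = ((\<lambda>F z. 1 / of_nat r * d_dx r F z) ^^ k) (\<lambda>z. 1 / (1 - of_nat r * z ^ r))"

definition B_kernel :: "complex \<Rightarrow> complex \<Rightarrow> complex" where
  "B_kernel z1 z2 = 1 / (z1 - z2)\<^sup>2"

text \<open>
  A local primitive on a punctured disc about \<open>q\<close>; it exists for meromorphic \<open>\<nu>\<close> with zero residue
  at \<open>q\<close> and is unique up to a constant, which does not contribute to \<open>res_primitive \<mu> \<nu> q\<close>
  when \<open>\<mu>\<close> has zero residue at \<open>q\<close>.
\<close>

definition primitive_near :: "(complex \<Rightarrow> complex) \<Rightarrow> complex \<Rightarrow> complex \<Rightarrow> complex" where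
  "primitive_near \<nu> q =
     (SOME N. \<exists>\<epsilon>>0. \<forall>z\<in>ball q \<epsilon> - {q}. (N has_field_derivative \<nu> z) (at z))"

definition res_primitive :: "(complex \<Rightarrow> complex) \<Rightarrow> (complex \<Rightarrow> complex) \<Rightarrow> complex \<Rightarrow> complex" where
  "res_primitive \<mu> \<nu> q = residue (\<lambda>z. \<mu> z * primitive_near \<nu> q z) q"

definition pairing :: "nat \<Rightarrow> (complex \<Rightarrow> complex) \<Rightarrow> (complex \<Rightarrow> complex) \<Rightarrow> complex" where
  "pairing r \<mu> \<nu> = (\<Sum>q | of_nat r * q ^ r = 1. res_primitive \<mu> \<nu> q)"

text \<open>
  \<open>Phi r n\<close> is the coefficient of \<open>\<hbar>\<^sup>n\<close> in \<open>\<Phi>\<close>. The series \<open>1/S(t) - 1\<close> has no constant term,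
  so \<open>y\<close> enters the residues at the points \<open>a\<close> only through \<open>\<partial>\<^sub>x\<^sup>n y\<close> with \<open>n \<ge> 1\<close>.
\<close>

definition Phi :: "nat \<Rightarrow> nat \<Rightarrow> complex \<Rightarrow> complex" where
  "Phi r n = (\<lambda>z.
     if n = 0 then (y_fun r z - z ^ r) * dx r z
     else \<Sum>a | a ^ r = -1.
            res_primitive (\<lambda>t. fps_nth (inverse S_fps) n * d_dx_y r n t * dx r t) (\<lambda>t. B_kernel t z) a)"

definition f_ser :: "nat \<Rightarrow> nat \<Rightarrow> complex fps" where
  "f_ser r k = Abs_fps (\<lambda>n. pairing r (deriv (xi_fun r k)) (Phi r n))"


section \<open>The starred series\<close>

definition ustar :: "nat \<Rightarrow> complex fps" where
  "ustar r = (THE u. (\<forall>n. odd n \<longrightarrow> fps_nth u n = 0) \<and> fps_nth u 0 = 0 \<and>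
     (\<lambda>m. f_ser r m * u ^ m * fps_const (1 / fact m)) sums (fps_const (1 / of_nat r) * u))"

definition fstar :: "nat \<Rightarrow> nat \<Rightarrow> complex fps" where
  "fstar r k = (\<Sum>m. f_ser r (k + m) * ustar r ^ m * fps_const (1 / fact m))"

definition Cstar :: "nat \<Rightarrow> complex fps" where
  "Cstar r = fps_const (1 / of_nat r) - fstar r 1"

text \<open>Here the outer series variable is \<open>t\<close> and the coefficients are power series in \<open>\<hbar>\<close>;
  \<open>s\<close> stands for \<open>\<Sum>i\<ge>1. s\<^sub>i\<^sup>* t\<^sup>i\<close>.\<close>

definition sstar_series :: "nat \<Rightarrow> complex fps fps" where
  "sstar_series r = (THE s. fps_nth s 0 = 0 \<and>
     fps_exp 1 oo (- s) =
       1 - Abs_fps (\<lambda>k. if k = 0 then 0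
                        else fstar r (k + 1) * inverse (fps_const (1 / of_nat r) - fstar r 1)))"

definition sstar :: "nat \<Rightarrow> nat \<Rightarrow> complex fps" where
  "sstar r k = fps_nth (sstar_series r) k"


section \<open>The \<open>w\<close>-side\<close>

text \<open>
  Functions of \<open>w\<close> are replaced by their Laurent expansions at \<open>w = 0\<close>, so a power series in
  \<open>\<hbar>\<close> whose coefficients have poles of finite order at \<open>w = 0\<close> is a \<open>complex fls fps\<close>. Operations
  in \<open>w\<close> act on it coefficientwise.
\<close>

definition fps_map :: "('a \<Rightarrow> 'b) \<Rightarrow> 'a fps \<Rightarrow> 'b fps" where
  "fps_map g F = Abs_fps (\<lambda>n. g (fps_nth F n))"

definition log_1_minus_w :: "complex fls" where
  "log_1_minus_w = fps_to_fls (fps_ln 1 oo (- fps_X))"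

definition u_w :: "nat \<Rightarrow> complex fls" where
  "u_w r = log_1_minus_w - of_nat r * fls_X"

definition d_du :: "nat \<Rightarrow> complex fls \<Rightarrow> complex fls" where
  "d_du r F = (fls_X - 1) / (1 + of_nat r - of_nat r * fls_X) * fls_deriv F"

abbreviation d_du_h :: "nat \<Rightarrow> complex fls fps \<Rightarrow> complex fls fps" where
  "d_du_h r \<equiv> fps_map (d_du r)"

definition W_ser :: "nat \<Rightarrow> complex fls fps" where
  "W_ser r = Abs_fps (\<lambda>n. fls_const (fps_nth (inverse S_fps) n * of_nat r ^ n) *
                      (d_du r ^^ n) log_1_minus_w)"

text \<open>\<open>d log F = (\<partial>\<^sub>w F / F) dw\<close>. Since the coefficients lie in a field, \<open>1 / F\<close> is the
  expansion in powers of \<open>\<hbar>\<close> whenever \<open>F\<close> is nonzero at \<open>\<hbar> = 0\<close>.\<close>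

definition dlog :: "complex fls fps \<Rightarrow> complex fls fps" where
  "dlog F = fps_map fls_deriv F * inverse F"

definition res_w :: "complex fls fps \<Rightarrow> complex fps" where
  "res_w = fps_map fls_residue"

text \<open>The logarithm of a power series with constant term \<open>1\<close> over a ring containing the rationals
  (\<^const>\<open>fps_ln\<close> needs a field of coefficients).\<close>

definition fps_log :: "'a::{comm_ring_1,inverse} fps \<Rightarrow> 'a fps" where
  "fps_log F =
     Abs_fps (\<lambda>n. if n = 0 then 0 else (-1) ^ (n - 1) * inverse (of_nat n)) oo (F - 1)"

text \<open>\<open>(\<partial>\<^sub>u / (1 - \<tau> \<partial>\<^sub>u)) F\<close> as a power series in \<open>\<tau>\<close> over the power series in \<open>\<hbar>\<close>.\<close>

definition d_du_geometric :: "nat \<Rightarrow> complex fls fps \<Rightarrow> complex fls fps fps" where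
  "d_du_geometric r F = Abs_fps (\<lambda>i. (d_du_h r ^^ (i + 1)) F)"

end

theory Submission
  imports Defs
begin

unbundle fps_syntax
unbundle no vec_syntax

text \<open>
  All functions involved depend on \<open>z\<close> only through \<open>Z = z\<^sup>r = w - 1\<close>, and \<open>(1/r) \<partial>\<^sub>x\<close> becomes \<open>\<partial>\<^sub>u\<close>, with
  \<open>\<xi>\<^sub>r\<^sub>,\<^sub>k = \<partial>\<^sub>u\<^sup>k\<^sup>+\<^sup>1 log (1 - w)\<close>. Moving the residues defining \<open>f\<^sub>k\<close> from the branch points to the poles
  \<open>a\<^sup>r = -1\<close> of \<open>dy\<close> and integrating by parts until only the simple pole of \<open>dy\<close> is left gives
  \<open>f\<^sub>k = C \<delta>\<^sub>k\<^sub>,\<^sub>1 - (\<partial>\<^sub>u\<^sup>k W)(w = 0)\<close>; the term \<open>C\<close> comes from \<open>z = \<infinity>\<close>. By Taylor expansion in \<open>u\<close> the equation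
  for \<open>u\<^sup>*\<close> says that \<open>u\<^sup>*\<close> is the \<open>u\<close>-coordinate of the root of \<open>W\<close> near \<open>w = 0\<close>, and the other starred
  series are values at that root. Finally \<open>g \<mapsto> res g d log W\<close> is evaluation at this root: it is a ring
  homomorphism on series regular at \<open>w = 0\<close>, so it also commutes with the logarithm.
\<close>

section \<open>Residues\<close>

text \<open>The residues in \<open>z\<close> are analytic and those in \<open>w\<close> are formal;
  the root of \<open>W\<close> exists only as a power series in \<hbar>, so no contour can enclose
  it. The two sides meet in numbers: the value of \<open>xi_rat r m\<close> at \<open>Z = -1\<close>
  is the constant term at \<open>w = 0\<close> of an iterated
  \<open>\<partial>\<^sub>u\<close>-derivative of \<open>log (1 - w)\<close>. The order of \<hbar>
  decides how a coefficient of \<open>f_ser\<close> is computed. From order 2 on, the form inside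
  the residue at \<open>a\<close> is exact, so the primitive of \<open>B_kernel\<close> may be
  chosen freely. Order 1 vanishes because 1/S is even. At order 0 the multivalued \<open>y\<close>
  itself occurs, and one integration by parts replaces it by the rational \<open>dy\<close>.
  Evenness of 1/S also fixes the sign: only for even n is \<open>(- r)^(n-1)\<close> equal to
  \<open>- r^(n-1)\<close>. The summand C of \<open>f_ser r 1\<close> cancels the left-hand side of
  the equation for \<open>ustar\<close>. What remains says that the Taylor series of
  \<open>W\<close> in \<open>u\<close> vanishes, and its linear coefficient,
  \<open>1 / (1 + r)\<close> at \<hbar> = 0, makes the small solution unique.\<close>

lemma sum_residues_eq_limit:
  fixes f :: "complex \<Rightarrow> complex"
  assumes S: "finite S" and f: "f holomorphic_on - S"
    and lim: "((\<lambda>z. z * f z) \<longlongrightarrow> L) at_infinity"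
  shows "(\<Sum>p\<in>S. residue f p) = L"
proof (rule ccontr)
  define D where "D = (\<Sum>p\<in>S. residue f p) - L"
  assume "(\<Sum>p\<in>S. residue f p) \<noteq> L"
  then have D: "norm D > 0" by (simp add: D_def)
  obtain b where b: "\<And>z. norm z \<ge> b \<Longrightarrow> dist (z * f z) L < norm D / 2"
    using lim D unfolding tendsto_iff eventually_at_infinity by (metis half_gt_zero)
  obtain c where c: "\<And>p. p \<in> S \<Longrightarrow> norm p \<le> c"
    using finite_imp_bounded[OF S] by (auto simp: bounded_iff)
  define R where "R = max 1 (max b (c + 1))"
  have R: "R > 0" "R \<ge> b" "\<And>p. p \<in> S \<Longrightarrow> norm p < R"
    using c by (force simp: R_def)+
  let ?g = "circlepath 0 R"
  have path: "path_image ?g \<subseteq> - S" using R by (force simp: path_image_circlepath)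
  have "contour_integral ?g f = 2 * pi * \<i> * (\<Sum>p\<in>S. winding_number ?g p * residue f p)"
    by (rule Residue_theorem[of UNIV]) (use S f path in \<open>auto simp: Compl_eq_Diff_UNIV\<close>)
  also have "(\<Sum>p\<in>S. winding_number ?g p * residue f p) = (\<Sum>p\<in>S. residue f p)"
    using R by (intro sum.cong refl) (simp add: winding_number_circlepath)
  finally have 1: "contour_integral ?g f = 2 * pi * \<i> * (\<Sum>p\<in>S. residue f p)" .
  have "f contour_integrable_on ?g"
    by (rule contour_integrable_holomorphic_simple[of f "- S"])
       (use f path S in \<open>auto simp: finite_imp_closed open_Compl\<close>)
  then have 2: "(f has_contour_integral 2 * pi * \<i> * (\<Sum>p\<in>S. residue f p)) ?g"
    using 1 has_contour_integral_integral by metis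
  have 3: "((\<lambda>z. L / (z - 0)) has_contour_integral 2 * of_real pi * \<i> * L) ?g"
    by (rule Cauchy_integral_circlepath_simple) (use R in auto)
  \<comment> \<open>The integral of \<open>f z - L / z\<close> has modulus
    \<open>2 * pi * norm D\<close>, while the estimate of the integrand by
    \<open>norm D / (2 * R)\<close> on the circle allows only half of that.\<close>
  have "((\<lambda>z. f z - L / z) has_contour_integral 2 * pi * \<i> * D) ?g"
    using has_contour_integral_diff[OF 2 3] by (simp add: D_def algebra_simps)
  then have "norm (2 * pi * \<i> * D) \<le> (norm D / 2 / R) * (2 * pi * R)"
  proof (rule has_contour_integral_bound_circlepath)
    fix z :: complex assume z: "norm (z - 0) = R"
    then have "z \<noteq> 0" using R by auto
    then have "norm (f z - L / z) = norm (z * f z - L) / R"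
    proof -
      have "f z - L / z = (z * f z - L) / z" using \<open>z \<noteq> 0\<close> by (simp add: field_simps)
      then show ?thesis using z by (simp add: norm_divide)
    qed
    also have "\<dots> \<le> norm D / 2 / R"
      using b[of z] z R by (intro divide_right_mono) (auto simp: dist_norm)
    finally show "norm (f z - L / z) \<le> norm D / 2 / R" .
  qed (use R in auto)
  then show False using D R by (simp add: norm_mult)
qed

lemma residue_deriv_eq_0:
  assumes S: "open S" "z \<in> S" and f: "f holomorphic_on S - {z}"
  shows "residue (deriv f) z = 0"
proof -
  obtain e where e: "e > 0" "cball z e \<subseteq> S" using S open_contains_cball_eq by blast
  have "(deriv f has_contour_integral 2 * pi * \<i> * residue (deriv f) z) (circlepath z e)"
    by (rule base_residue[of S]) (use S f e in \<open>auto intro!: holomorphic_deriv\<close>)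
  moreover have "(deriv f has_contour_integral 0) (circlepath z e)"
    by (rule Cauchy_theorem_primitive[of "S - {z}" f])
       (use S f e in \<open>auto intro!: holomorphic_derivI[of f] simp: path_image_circlepath\<close>)
  ultimately have "2 * pi * \<i> * residue (deriv f) z = 0" by (rule has_contour_integral_unique)
  then show ?thesis by simp
qed

lemma residue_by_parts:
  assumes S: "open S" "z \<in> S" and f: "f holomorphic_on S - {z}" and g: "g holomorphic_on S - {z}"
  shows "residue (\<lambda>w. f w * deriv g w) z = - residue (\<lambda>w. deriv f w * g w) z"
proof -
  have fg: "deriv f holomorphic_on S - {z}" "deriv g holomorphic_on S - {z}"
    using S f g by (auto intro!: holomorphic_deriv)
  have "0 = residue (deriv (\<lambda>w. f w * g w)) z"
    by (rule residue_deriv_eq_0[symmetric, OF S]) (intro holomorphic_intros f g)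
  also have "\<dots> = residue (\<lambda>w. f w * deriv g w + deriv f w * g w) z"
  proof (rule residue_cong)
    have "eventually (\<lambda>w. w \<in> S - {z}) (at z)" using S by (intro eventually_at_in_open)
    then show "\<forall>\<^sub>F w in at z. deriv (\<lambda>w. f w * g w) w = f w * deriv g w + deriv f w * g w"
    proof eventually_elim
      case (elim w)
      then have "f field_differentiable at w" "g field_differentiable at w"
        using f g S by (auto simp: holomorphic_on_open field_differentiable_def open_delete)
      then show ?case by simp
    qed
  qed simp
  also have "\<dots> = residue (\<lambda>w. f w * deriv g w) z + residue (\<lambda>w. deriv f w * g w) z"
    by (rule residue_add[OF S]) (intro holomorphic_intros f g fg)+
  finally show ?thesis by (simp add: eq_neg_iff_add_eq_0)
qed

text \<open>Since a punctured disc is connected, the primitive selected by \<open>SOME\<close>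
  differs from \<open>N\<close> by a constant there; the constant contributes a multiple of
  \<open>residue \<mu> q\<close>, which is 0.\<close>

lemma res_primitive_eq:
  assumes S: "open S" "q \<in> S" and \<mu>: "\<mu> holomorphic_on S - {q}" "residue \<mu> q = 0"
    and N: "\<And>z. z \<in> S - {q} \<Longrightarrow> (N has_field_derivative \<nu> z) (at z)"
  shows "res_primitive \<mu> \<nu> q = residue (\<lambda>z. \<mu> z * N z) q"
proof -
  obtain e where e: "e > 0" "ball q e \<subseteq> S" using S open_contains_ball_eq by blast
  let ?P = "primitive_near \<nu> q"
  have "\<exists>\<epsilon>>0. \<forall>z\<in>ball q \<epsilon> - {q}. (N has_field_derivative \<nu> z) (at z)"
    using e N by (intro exI[of _ e]) auto
  then have "\<exists>M. \<exists>\<epsilon>>0. \<forall>z\<in>ball q \<epsilon> - {q}. (M has_field_derivative \<nu> z) (at z)"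
    by (rule exI[of _ N])
  from someI_ex[OF this]
  have "\<exists>\<epsilon>>0. \<forall>z\<in>ball q \<epsilon> - {q}. (?P has_field_derivative \<nu> z) (at z)"
    unfolding primitive_near_def .
  then obtain d where d: "d > 0" "\<And>z. z \<in> ball q d - {q} \<Longrightarrow> (?P has_field_derivative \<nu> z) (at z)"
    by blast
  define U where "U = ball q (min d e)"
  have U: "open U" "q \<in> U" "U \<subseteq> S" using d e by (auto simp: U_def)
  have conn: "connected (U - {q})" unfolding U_def
    by (rule connected_punctured_ball) simp
  have "\<exists>c. \<forall>z\<in>U - {q}. ?P z - N z = c"
  proof -
    have "((\<lambda>z. ?P z - N z) has_field_derivative 0) (at z)" if "z \<in> U - {q}" for z
      using DERIV_diff[OF d(2)[of z] N[of z]] that U by (auto simp: U_def)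
    then have "(\<lambda>z. ?P z - N z) constant_on (U - {q})"
      by (rule has_field_derivative_0_imp_constant_on)
         (use conn U in \<open>auto simp: open_delete\<close>)
    then show ?thesis by (simp add: constant_on_def)
  qed
  then obtain c where c: "\<And>z. z \<in> U - {q} \<Longrightarrow> ?P z = N z + c" by (metis diff_add_cancel add.commute)
  have hol: "\<mu> holomorphic_on U - {q}" "N holomorphic_on U - {q}"
  proof -
    show "\<mu> holomorphic_on U - {q}" using \<mu>(1) by (rule holomorphic_on_subset) (use U in auto)
    show "N holomorphic_on U - {q}"
      using N U by (force simp: holomorphic_on_open open_delete)
  qed
  have "res_primitive \<mu> \<nu> q = residue (\<lambda>z. \<mu> z * N z + c * \<mu> z) q"
    unfolding res_primitive_def
  proof (rule residue_cong)
    have "eventually (\<lambda>w. w \<in> U - {q}) (at q)" using U by (intro eventually_at_in_open)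
    then show "\<forall>\<^sub>F z in at q. \<mu> z * ?P z = \<mu> z * N z + c * \<mu> z"
      by eventually_elim (simp add: c algebra_simps)
  qed simp
  also have "\<dots> = residue (\<lambda>z. \<mu> z * N z) q + residue (\<lambda>z. c * \<mu> z) q"
    by (rule residue_add[OF U(1,2)]) (intro holomorphic_intros hol)+
  also have "residue (\<lambda>z. c * \<mu> z) q = 0"
    using residue_lmul[OF U(1,2) hol(1)] \<mu> by simp
  finally show ?thesis by simp
qed

text \<open>Integration by parts moves the derivative from \<open>m\<close> to the primitive and so
  removes the primitive. It applies to the pairing because \<open>Phi\<close> is holomorphic at the
  branch points.\<close>

lemma res_primitive_deriv:
  assumes S: "open S" "q \<in> S" and m: "m holomorphic_on S - {q}" and \<nu>: "\<nu> holomorphic_on S"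
  shows "res_primitive (deriv m) \<nu> q = - residue (\<lambda>z. m z * \<nu> z) q"
proof -
  obtain e where e: "e > 0" "ball q e \<subseteq> S" using S open_contains_ball_eq by blast
  have "\<nu> holomorphic_on ball q e" using \<nu> e holomorphic_on_subset by blast
  then obtain N where N: "\<And>z. z \<in> ball q e \<Longrightarrow> (N has_field_derivative \<nu> z) (at z within ball q e)"
    using holomorphic_convex_primitive'[OF convex_ball open_ball] by metis
  then have N: "\<And>z. z \<in> ball q e \<Longrightarrow> (N has_field_derivative \<nu> z) (at z)"
    by (simp add: at_within_open[OF _ open_ball])
  have m': "m holomorphic_on ball q e - {q}" using m e by (auto intro: holomorphic_on_subset)
  have Nh: "N holomorphic_on ball q e - {q}" using N by (force simp: holomorphic_on_open open_delete)
  have "res_primitive (deriv m) \<nu> q = residue (\<lambda>z. deriv m z * N z) q"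
    using e m' N by (intro res_primitive_eq[of "ball q e"] holomorphic_deriv residue_deriv_eq_0[of "ball q e"]) auto
  also have "\<dots> = - residue (\<lambda>z. m z * deriv N z) q"
    using residue_by_parts[of "ball q e" q m N] m' Nh e by simp
  also have "residue (\<lambda>z. m z * deriv N z) q = residue (\<lambda>z. m z * \<nu> z) q"
  proof (rule residue_cong)
    have "eventually (\<lambda>w. w \<in> ball q e - {q}) (at q)" using e by (intro eventually_at_in_open) auto
    then show "\<forall>\<^sub>F z in at q. m z * deriv N z = m z * \<nu> z"
      by eventually_elim (use N in \<open>auto dest!: DERIV_imp_deriv\<close>)
  qed simp
  finally show ?thesis .
qed

lemma residue_sum:
  assumes S: "open S" "z \<in> S" and "\<And>i. i \<in> I \<Longrightarrow> f i holomorphic_on S - {z}"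
  shows "residue (\<lambda>w. \<Sum>i\<in>I. f i w) z = (\<Sum>i\<in>I. residue (f i) z)"
  using assms(3)
proof (induction I rule: infinite_finite_induct)
  case (insert i I)
  then have "residue (\<lambda>w. f i w + (\<Sum>i\<in>I. f i w)) z = residue (f i) z + residue (\<lambda>w. \<Sum>i\<in>I. f i w) z"
    by (intro residue_add[OF S] holomorphic_intros) auto
  with insert show ?case by simp
qed (auto simp: residue_const)

section \<open>Principal parts, the Cauchy kernel and residue reciprocity\<close>

lemma fls_residue_times_fps:
  fixes F :: "complex fls"
  assumes "\<And>n. n < - int N \<Longrightarrow> F $$ n = 0"
  shows "fls_residue (F * fps_to_fls G) = (\<Sum>j<N. F $$ (-1 - int j) * fps_nth G j)"
proof -
  \<comment> \<open>Principal part plus regular part. Only the former, a finite sum, meets the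
    coefficients of \<open>G\<close> in degree -1.\<close>
  have "F = (\<Sum>j<N. fls_const (F $$ (-1 - int j)) * fls_X_intpow (-1 - int j)) + fps_to_fls (fls_regpart F)"
  proof (rule fls_eqI)
    fix n :: int
    have "(\<Sum>j<N. fls_const (F $$ (-1 - int j)) * fls_X_intpow (-1 - int j)) $$ n
        = (\<Sum>j<N. if j = nat (-1 - n) \<and> n < 0 then F $$ n else 0)"
      unfolding fls_nth_sum by (intro sum.cong) auto
    also have "\<dots> = (if n < 0 then F $$ n else 0)"
      using assms[of n] by (cases "n < 0") auto
    finally show "F $$ n = ((\<Sum>j<N. fls_const (F $$ (-1 - int j)) * fls_X_intpow (-1 - int j))
        + fps_to_fls (fls_regpart F)) $$ n"
      by auto
  qed
  then have "F * fps_to_fls G = (\<Sum>j<N. fls_const (F $$ (-1 - int j)) * (fls_X_intpow (-1 - int j) * fps_to_fls G))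
      + fps_to_fls (fls_regpart F * G)"
    by (metis (no_types, lifting) distrib_right fls_times_fps_to_fls mult.assoc sum.cong sum_distrib_right)
  moreover have "fls_residue (fls_X_intpow (-1 - int j) * fps_to_fls G) = fps_nth G j" for j
    using fls_residue_shift_nth[of "fps_to_fls G" "int j"] by (simp add: algebra_simps)
  ultimately show ?thesis by (simp add: fls_nth_sum del: fls_times_fps_to_fls)
qed

lemma residue_times_analytic:
  assumes f: "(\<lambda>x. f (a + x)) has_laurent_expansion F" and N: "\<And>n. n < - int N \<Longrightarrow> F $$ n = 0"
    and g: "(\<lambda>x. g (a + x)) has_fps_expansion G"
  shows "residue (\<lambda>z. f z * g z) a = (\<Sum>j<N. F $$ (-1 - int j) * fps_nth G j)"
proof -
  have "residue (\<lambda>z. f z * g z) a = fls_residue (F * fps_to_fls G)"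
    by (rule has_laurent_expansion_residue) (intro laurent_expansion_intros f has_laurent_expansion_fps g)
  then show ?thesis using fls_residue_times_fps[OF N] by metis
qed

lemma inverse_const_minus_fps_X:
  fixes c :: "'a :: field"
  assumes "c \<noteq> 0"
  shows "inverse (fps_const c - fps_X) = Abs_fps (\<lambda>j. 1 / c ^ (j + 1))"
proof (rule fps_inverse_unique, rule fps_ext)
  fix n
  show "((fps_const c - fps_X) * Abs_fps (\<lambda>j. 1 / c ^ (j + 1))) $ n = 1 $ n"
    using assms by (cases n) (auto simp: left_diff_distrib)
qed

text \<open>Expanding \<open>1 / (z - t)\<close> as a geometric series in \<open>t - a\<close>
  reproduces, as a function of \<open>z\<close>, the principal part of \<open>f\<close> at
  \<open>a\<close>. The residue is thus a rational function of \<open>z\<close> with its only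
  possible pole at \<open>a\<close>.\<close>

lemma residue_cauchy_kernel:
  assumes f: "(\<lambda>x. f (a + x)) has_laurent_expansion F" and N: "\<And>n. n < - int N \<Longrightarrow> F $$ n = 0"
    and "z \<noteq> a"
  shows "residue (\<lambda>t. f t * (1 / (z - t))) a = (\<Sum>j<N. F $$ (-1 - int j) / (z - a) ^ (j + 1))"
proof -
  have "(\<lambda>x. inverse ((z - a) - x)) has_fps_expansion inverse (fps_const (z - a) - fps_X)"
    by (intro fps_expansion_intros) (use assms in auto)
  then have "(\<lambda>x. 1 / (z - (a + x))) has_fps_expansion Abs_fps (\<lambda>j. 1 / (z - a) ^ (j + 1))"
    using assms by (subst (asm) inverse_const_minus_fps_X) (auto simp: field_simps)
  from residue_times_analytic[OF f N this] show ?thesis by simp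
qed

lemma tendsto_inverse_diff_at_infinity:
  fixes a :: complex
  shows "((\<lambda>z. 1 / (z - a)) \<longlongrightarrow> 0) at_infinity"
proof -
  have "filterlim (\<lambda>z. z - a) at_infinity at_infinity"
    using tendsto_add_filterlim_at_infinity'[OF filterlim_ident tendsto_const[of "- a"]] by simp
  from filterlim_compose[OF tendsto_inverse_0 this] show ?thesis
    by (simp add: divide_inverse)
qed

text \<open>The inner residue is the principal part \<open>P\<close> of \<open>f\<close> at
  \<open>a\<close>. The product \<open>P * \<xi>\<close> has poles only in \<open>Q\<close> and at
  \<open>a\<close> and decays faster than 1/z, so its residues add up to 0. At \<open>a\<close> the
  analytic factor \<open>\<xi>\<close> sees only the principal part, so \<open>P\<close> may be
  replaced by \<open>f\<close> there.\<close>

lemma sum_residue_reciprocity: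
  assumes Q: "finite Q" "a \<notin> Q" and \<xi>: "\<xi> holomorphic_on - Q" "(\<xi> \<longlongrightarrow> 0) at_infinity"
    and f: "f meromorphic_on {a}"
  shows "(\<Sum>q\<in>Q. residue (\<lambda>z. \<xi> z * residue (\<lambda>t. f t * (1 / (z - t))) a) q) = - residue (\<lambda>z. f z * \<xi> z) a"
proof -
  obtain F where F: "(\<lambda>x. f (a + x)) has_laurent_expansion F"
    using f by (auto simp: meromorphic_on_def)
  define N where "N = nat (- fls_subdegree F)"
  have N: "F $$ n = 0" if "n < - int N" for n
    using that by (intro fls_eq0_below_subdegree) (auto simp: N_def split: if_splits)
  define P where "P = (\<lambda>z. \<Sum>j<N. F $$ (-1 - int j) / (z - a) ^ (j + 1))"
  have "open (- Q)" using Q by (simp add: finite_imp_closed open_Compl)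
  then have "\<xi> analytic_on {a}" using \<xi> Q by (auto simp: analytic_at)
  then have G: "(\<lambda>x. \<xi> (a + x)) has_fps_expansion fps_expansion \<xi> a"
    by (rule analytic_at_imp_has_fps_expansion)
  have Ph: "P holomorphic_on - {a}" unfolding P_def by (intro holomorphic_intros) auto
  let ?F = "\<Sum>j<N. fls_const (F $$ (-1 - int j)) * fls_X_intpow (-1 - int j)"
  have coeff: "?F $$ n = (\<Sum>j<N. if n = -1 - int j then F $$ n else 0)" for n
    unfolding fls_nth_sum by (intro sum.cong) auto
  have P: "(\<lambda>x. P (a + x)) has_laurent_expansion ?F"
  proof -
    have "(\<lambda>x. \<Sum>j<N. F $$ (-1 - int j) * x powi (-1 - int j)) has_laurent_expansion ?F"
      by (intro laurent_expansion_intros)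
    moreover have "x powi (-1 - int j) = 1 / x ^ (j + 1)" for x :: complex and j
      by (simp add: power_int_def nat_add_distrib field_simps)
    ultimately show ?thesis by (simp add: P_def)
  qed
  have *: "residue (\<lambda>z. P z * \<xi> z) a = residue (\<lambda>z. f z * \<xi> z) a"
  proof -
    have c: "?F $$ (-1 - int j) = F $$ (-1 - int j)" if "j < N" for j
      unfolding coeff using that by simp
    have v: "?F $$ n = 0" if "n < - int N" for n
      unfolding coeff using that by (intro sum.neutral) auto
    show ?thesis
      using residue_times_analytic[OF P v G] residue_times_analytic[OF F N G] c by simp
  qed
  \<comment> \<open>Write \<open>z / (z - a)\<close> as \<open>1 + a / (z - a)\<close>; by
    \<open>0 ^ 0 = 1\<close> the limit is the coefficient of degree -1. Its finiteness suffices, as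
    \<open>\<xi>\<close> tends to 0.\<close>
  have "((\<lambda>z. z * P z) \<longlongrightarrow> (\<Sum>j<N. F $$ (-1 - int j) * ((1 + a * 0) * 0 ^ j))) at_infinity"
  proof (rule Lim_transform_eventually)
    show "((\<lambda>z. \<Sum>j<N. F $$ (-1 - int j) * ((1 + a * (1 / (z - a))) * (1 / (z - a)) ^ j)) \<longlongrightarrow> 
        (\<Sum>j<N. F $$ (-1 - int j) * ((1 + a * 0) * 0 ^ j))) at_infinity"
      by (intro tendsto_intros tendsto_inverse_diff_at_infinity)
    have "eventually (\<lambda>z. z \<noteq> a) at_infinity" by (rule eventually_not_equal_at_infinity)
    then show "\<forall>\<^sub>F z in at_infinity. (\<Sum>j<N. F $$ (-1 - int j) * ((1 + a * (1 / (z - a))) * (1 / (z - a)) ^ j)) = z * P z"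
      unfolding P_def sum_distrib_left by eventually_elim (auto intro!: sum.cong simp: field_simps)
  qed
  from tendsto_mult[OF this \<xi>(2)]
  have "(\<Sum>q\<in>insert a Q. residue (\<lambda>z. P z * \<xi> z) q) = 0"
    using Q Ph \<xi> by (intro sum_residues_eq_limit) (auto simp: mult.assoc intro!: holomorphic_intros elim: holomorphic_on_subset)
  then have "(\<Sum>q\<in>Q. residue (\<lambda>z. P z * \<xi> z) q) = - residue (\<lambda>z. f z * \<xi> z) a"
    using Q by (simp add: * eq_neg_iff_add_eq_0 add.commute)
  moreover have "residue (\<lambda>z. P z * \<xi> z) q = residue (\<lambda>z. \<xi> z * residue (\<lambda>t. f t * (1 / (z - t))) a) q"
    if "q \<in> Q" for q
  proof (rule residue_cong)
    have "eventually (\<lambda>z. z \<in> - {a}) (at q)" using that Q by (intro eventually_at_in_open') auto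
    then show "\<forall>\<^sub>F z in at q. P z * \<xi> z = \<xi> z * residue (\<lambda>t. f t * (1 / (z - t))) a"
      by eventually_elim (subst residue_cauchy_kernel[OF F N], auto simp: P_def)
  qed simp
  ultimately show ?thesis by simp
qed

lemma holomorphic_residue_cauchy_kernel:
  assumes "f meromorphic_on {a}"
  shows "(\<lambda>z. residue (\<lambda>t. f t * (1 / (z - t))) a) holomorphic_on - {a}"
proof -
  obtain F where F: "(\<lambda>x. f (a + x)) has_laurent_expansion F"
    using assms by (auto simp: meromorphic_on_def)
  define N where "N = nat (- fls_subdegree F)"
  have N: "F $$ n = 0" if "n < - int N" for n
    using that by (intro fls_eq0_below_subdegree) (auto simp: N_def split: if_splits)
  have "(\<lambda>z. \<Sum>j<N. F $$ (-1 - int j) / (z - a) ^ (j + 1)) holomorphic_on - {a}"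
    by (intro holomorphic_intros) auto
  then show ?thesis
    by (rule holomorphic_transform) (subst residue_cauchy_kernel[OF F N], auto)
qed

section \<open>Residues on the spectral curve\<close>

text \<open>Numerators of the iterates of \<open>Z / (1 - r Z) d/dZ\<close> applied to
  \<open>1 / (1 - r Z)\<close>; with \<open>Z = z^r\<close> this operator is
  \<open>(1/r) \<partial>\<^sub>x\<close>. Each application raises the exponent of the denominator
  by two, once by differentiating and once by the factor \<open>1 / (1 - r Z)\<close>.\<close>

primrec xi_poly :: "nat \<Rightarrow> nat \<Rightarrow> complex poly" where
  "xi_poly r 0 = 1"
| "xi_poly r (Suc m) = pCons 0 (pderiv (xi_poly r m) * [:1, - of_nat r:]
     + smult (of_nat ((2 * m + 1) * r)) (xi_poly r m))"

definition xi_rat :: "nat \<Rightarrow> nat \<Rightarrow> complex \<Rightarrow> complex" where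
  "xi_rat r m Z = poly (xi_poly r m) Z / (1 - of_nat r * Z) ^ (2 * m + 1)"

text \<open>Degree at most \<open>m\<close> against \<open>2 * m + 1\<close> in the denominator:
  this yields all the decay at infinity used below.\<close>

lemma degree_xi_poly: "degree (xi_poly r m) \<le> m"
proof (induction m)
  case (Suc m)
  have "degree (pderiv (xi_poly r m) * [:1, - of_nat r:]) \<le> m"
  \<comment> \<open>For a constant polynomial the truncated subtraction in
    \<open>degree_pderiv\<close> would give the bound 1, too large when \<open>m = 0\<close>; its
    derivative is 0.\<close>
  proof (cases "degree (xi_poly r m) = 0")
    case True
    then show ?thesis by (simp add: pderiv_eq_0_iff[THEN iffD2])
  next
    case False
    have "degree (pderiv (xi_poly r m) * [:1, - of_nat r:]) \<le> degree (pderiv (xi_poly r m)) + 1"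
      by (rule order_trans[OF degree_mult_le]) simp
    with Suc False show ?thesis by (simp add: degree_pderiv)
  qed
  moreover have "degree (smult (of_nat ((2 * m + 1) * r)) (xi_poly r m)) \<le> m"
    using Suc degree_smult_le order_trans by blast
  ultimately show ?case
    by (simp add: degree_pCons_le[THEN order_trans] degree_add_le)
qed simp

lemma xi_rat_has_derivative:
  assumes "of_nat r * Z \<noteq> 1" "Z \<noteq> 0"
  shows "(xi_rat r m has_field_derivative (1 - of_nat r * Z) * xi_rat r (Suc m) Z / Z) (at Z)"
proof -
  have nz: "1 - of_nat r * Z \<noteq> 0" using assms by simp
  let ?d = "1 - of_nat r * Z" and ?p = "poly (xi_poly r m) Z" and ?p' = "poly (pderiv (xi_poly r m)) Z"
  have "(xi_rat r m has_field_derivative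
      (?p' * ?d ^ (2 * m + 1) - ?p * (of_nat (2 * m + 1) * ?d ^ (2 * m) * (- of_nat r)))
        / (?d ^ (2 * m + 1) * ?d ^ (2 * m + 1))) (at Z)"
    unfolding xi_rat_def [abs_def]
  proof (rule DERIV_divide)
    show "((\<lambda>Z. (1 - of_nat r * Z) ^ (2 * m + 1)) has_field_derivative
        of_nat (2 * m + 1) * ?d ^ (2 * m) * (- of_nat r)) (at Z)"
      by (rule derivative_eq_intros refl)+ (simp add: algebra_simps)
  qed (use nz in \<open>auto intro: poly_DERIV\<close>)
  also have "(?p' * ?d ^ (2 * m + 1) - ?p * (of_nat (2 * m + 1) * ?d ^ (2 * m) * (- of_nat r)))
        / (?d ^ (2 * m + 1) * ?d ^ (2 * m + 1))
      = (?p' * ?d + of_nat ((2 * m + 1) * r) * ?p) * ?d ^ (2 * m) / (?d ^ 2 * ?d ^ (2 * m) * ?d ^ (2 * m))"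
    by (simp add: algebra_simps power2_eq_square)
  also have "\<dots> = (?p' * ?d + of_nat ((2 * m + 1) * r) * ?p) / (?d ^ 2 * ?d ^ (2 * m))"
    using nz by simp
  also have "\<dots> = ?d * (Z * (?p' * ?d + of_nat ((2 * m + 1) * r) * ?p) / (?d ^ 3 * ?d ^ (2 * m))) / Z"
    using nz assms(2) by (simp add: power2_eq_square power3_eq_cube)
  also have "Z * (?p' * ?d + of_nat ((2 * m + 1) * r) * ?p) / (?d ^ 3 * ?d ^ (2 * m)) = xi_rat r (Suc m) Z"
  proof -
    have "Z * (?p' * ?d + of_nat ((2 * m + 1) * r) * ?p) = poly (xi_poly r (Suc m)) Z"
      by (simp add: algebra_simps)
    moreover have "?d ^ 3 * ?d ^ (2 * m) = ?d ^ (2 * Suc m + 1)"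
    proof -
      have "3 + 2 * m = 2 * Suc m + 1" by simp
      then show ?thesis by (metis power_add)
    qed
    ultimately show ?thesis by (simp only: xi_rat_def)
  qed
  finally show ?thesis .
qed

lemma xi_rat_tendsto_0: "(xi_rat r m \<longlongrightarrow> 0) at_infinity" if "r \<ge> 1"
proof -
  have "((\<lambda>Z. poly (xi_poly r m) Z / poly ([:1, - of_nat r:] ^ (2 * m + 1)) Z) \<longlongrightarrow> 0) at_infinity"
    using that degree_xi_poly[of r m]
    by (intro poly_divide_tendsto_0_at_infinity) (simp add: degree_power_eq del: power_Suc)
  then show ?thesis
    by (simp add: xi_rat_def [abs_def] poly_power mult_ac del: power_Suc)
qed

text \<open>The additional factor \<open>Z\<close> leaves degree \<open>m + 1\<close> below
  \<open>2 * m + 1\<close> once \<open>m \<ge> 1\<close>. For \<open>m = 0\<close> the limit would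
  be \<open>- 1 / r\<close>, and this exception is the origin of the term C.\<close>

lemma xi_rat_mult_tendsto_0:
  assumes "r \<ge> 1" "m \<ge> 1"
  shows "((\<lambda>Z. Z * xi_rat r m Z) \<longlongrightarrow> 0) at_infinity"
proof -
  have "((\<lambda>Z. poly (pCons 0 (xi_poly r m)) Z / poly ([:1, - of_nat r:] ^ (2 * m + 1)) Z) \<longlongrightarrow> 0) at_infinity"
    using assms degree_xi_poly[of r m] degree_pCons_le[of 0 "xi_poly r m"]
    by (intro poly_divide_tendsto_0_at_infinity) (simp add: degree_power_eq del: power_Suc)
  then show ?thesis
    by (simp add: xi_rat_def [abs_def] poly_power mult_ac del: power_Suc)
qed

section \<open>The special points of the spectral curve\<close>

definition branch_pts :: "nat \<Rightarrow> complex set" where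
  "branch_pts r = {q. of_nat r * q ^ r = 1}"

definition y_poles :: "nat \<Rightarrow> complex set" where
  "y_poles r = {a. a ^ r = -1}"

text \<open>The pole of \<open>dx\<close> at 0, the zeros of \<open>dx\<close> and the poles of
  \<open>dy\<close>. For a point \<open>p\<close> of this finite set, the complement of
  \<open>curve_pts r - {p}\<close> is an open neighbourhood of \<open>p\<close> containing no other
  special point; most residues below are computed there.\<close>

definition curve_pts :: "nat \<Rightarrow> complex set" where
  "curve_pts r = insert 0 (branch_pts r \<union> y_poles r)"

lemma card_y_poles: "r \<ge> 1 \<Longrightarrow> card (y_poles r) = r"
  unfolding y_poles_def by (rule card_nth_roots) auto

lemma finite_y_poles: "r \<ge> 1 \<Longrightarrow> finite (y_poles r)"
  using card_y_poles[of r] by (intro card_ge_0_finite) simp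

lemma finite_branch_pts: 
  assumes "r \<ge> 1"
  shows "finite (branch_pts r)"
proof -
  have "card {q::complex. q ^ r = 1 / of_nat r} = r" by (rule card_nth_roots) (use assms in auto)
  moreover have "{q::complex. q ^ r = 1 / of_nat r} = branch_pts r"
    using assms by (auto simp: branch_pts_def field_simps)
  ultimately show ?thesis using assms by (intro card_ge_0_finite) simp
qed

lemma y_poles_branch_pts_disjoint: "a \<in> y_poles r \<Longrightarrow> a \<notin> branch_pts r"
proof
  assume "a \<in> y_poles r" "a \<in> branch_pts r"
  then have "of_nat (r + 1) = (0 :: complex)"
    by (auto simp: y_poles_def branch_pts_def neg_eq_iff_add_eq_0 add.commute)
  then show False by (simp only: of_nat_eq_0_iff)
qed

lemma zero_notin_branch_pts: "r \<ge> 1 \<Longrightarrow> 0 \<notin> branch_pts r"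
  by (auto simp: branch_pts_def power_0_left)

lemma zero_notin_y_poles: "r \<ge> 1 \<Longrightarrow> 0 \<notin> y_poles r"
  by (auto simp: y_poles_def power_0_left)

lemma open_Compl_branch_pts: "r \<ge> 1 \<Longrightarrow> open (- insert 0 (branch_pts r))"
  by (auto intro!: open_Compl finite_imp_closed finite_branch_pts)

lemma open_Compl_curve_pts: "r \<ge> 1 \<Longrightarrow> open (- (curve_pts r - S))"
  unfolding curve_pts_def
  by (intro open_Compl finite_imp_closed finite_Diff) (auto simp: finite_branch_pts finite_y_poles)

lemma dx_eq: "r \<ge> 1 \<Longrightarrow> z \<noteq> 0 \<Longrightarrow> dx r z = (1 - of_nat r * z ^ r) / z"
  by (cases r) (auto simp: dx_def field_simps)

lemma dx_nonzero: "r \<ge> 1 \<Longrightarrow> z \<notin> insert 0 (branch_pts r) \<Longrightarrow> dx r z \<noteq> 0"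
  by (auto simp: dx_eq branch_pts_def)

lemma dx_holomorphic: "dx r holomorphic_on - {0}"
  unfolding dx_def [abs_def] by (intro holomorphic_intros) auto

lemma xi_rat_power_has_derivative:
  assumes "r \<ge> 1" "z \<notin> insert 0 (branch_pts r)"
  shows "((\<lambda>z. xi_rat r m (z ^ r)) has_field_derivative of_nat r * dx r z * xi_rat r (Suc m) (z ^ r)) (at z)"
proof -
  have "of_nat r * z ^ r \<noteq> 1" "z ^ r \<noteq> 0" "z \<noteq> 0"
    using assms by (auto simp: branch_pts_def)
  moreover have "((\<lambda>z. z ^ r) has_field_derivative of_nat r * z ^ (r - 1)) (at z)"
    by (auto intro!: derivative_eq_intros)
  ultimately have "((\<lambda>z. xi_rat r m (z ^ r)) has_field_derivative
      (1 - of_nat r * z ^ r) * xi_rat r (Suc m) (z ^ r) / z ^ r * (of_nat r * z ^ (r - 1))) (at z)"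
    by (intro DERIV_chain2[OF xi_rat_has_derivative])
  moreover have "z ^ r = z * z ^ (r - 1)" using assms by (cases r) auto
  ultimately show ?thesis
    using \<open>z \<noteq> 0\<close> assms by (simp add: dx_eq mult_ac)
qed

lemma xi_fun_eq:
  assumes "r \<ge> 1" "z \<notin> insert 0 (branch_pts r)"
  shows "xi_fun r m z = xi_rat r m (z ^ r)"
  using assms(2)
proof (induction m arbitrary: z)
  case 0
  then show ?case by (simp add: xi_fun_def xi_rat_def)
next
  case (Suc m)
  have "eventually (\<lambda>z. z \<in> - insert 0 (branch_pts r)) (nhds z)"
    using Suc.prems open_Compl_branch_pts[OF assms(1)] by (intro eventually_nhds_in_open) auto
  then have "eventually (\<lambda>z. xi_fun r m z = xi_rat r m (z ^ r)) (nhds z)"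
    by eventually_elim (rule Suc.IH, simp)
  then have "deriv (xi_fun r m) z = deriv (\<lambda>z. xi_rat r m (z ^ r)) z"
    by (rule deriv_cong_ev) simp
  also have "\<dots> = of_nat r * dx r z * xi_rat r (Suc m) (z ^ r)"
    using xi_rat_power_has_derivative[OF assms(1) Suc.prems] by (rule DERIV_imp_deriv)
  finally show ?case
    using dx_nonzero[OF assms(1) Suc.prems] assms(1) by (simp add: xi_fun_def d_dx_def)
qed

lemma xi_rat_power_holomorphic: "(\<lambda>z. xi_rat r m (z ^ r)) holomorphic_on - branch_pts r"
  unfolding xi_rat_def by (intro holomorphic_intros) (auto simp: branch_pts_def)

lemma xi_fun_holomorphic:
  assumes "r \<ge> 1"
  shows "xi_fun r m holomorphic_on - insert 0 (branch_pts r)"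
  by (rule holomorphic_transform[OF holomorphic_on_subset[OF xi_rat_power_holomorphic]])
     (use assms in \<open>auto simp: xi_fun_eq\<close>)

lemma filterlim_power_at_infinity_complex:
  "r \<ge> 1 \<Longrightarrow> filterlim (\<lambda>z::complex. z ^ r) at_infinity at_infinity"
  by (intro filterlim_power_at_infinity filterlim_ident) auto

lemma xi_rat_power_tendsto_0:
  "r \<ge> 1 \<Longrightarrow> ((\<lambda>z. xi_rat r m (z ^ r)) \<longlongrightarrow> 0) at_infinity"
  by (rule filterlim_compose[OF xi_rat_tendsto_0 filterlim_power_at_infinity_complex])

section \<open>The derivatives of \<open>y\<close> and their residues at the poles of
  \<open>dy\<close>\<close>

lemma dy_holomorphic: "dy r holomorphic_on - y_poles r"
  unfolding dy_def [abs_def] by (intro holomorphic_intros) (auto simp: y_poles_def add_eq_0_iff)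

lemma d_dx_y_1: "r \<ge> 1 \<Longrightarrow> z \<notin> insert 0 (branch_pts r) \<Longrightarrow> d_dx_y r (Suc 0) z * dx r z = dy r z"
  using dx_nonzero by (simp add: d_dx_y_def)

lemma d_dx_y_Suc: 
  assumes "r \<ge> 1" "z \<notin> insert 0 (branch_pts r)" "n \<ge> 1"
  shows "d_dx_y r (Suc n) z * dx r z = deriv (d_dx_y r n) z"
proof -
  obtain k where "n = Suc k" using assms(3) by (cases n) auto
  with dx_nonzero[OF assms(1,2)] show ?thesis by (simp add: d_dx_y_def d_dx_def)
qed

lemma d_dx_y_Suc_eq: "n \<ge> 1 \<Longrightarrow> d_dx_y r (Suc n) = (\<lambda>z. deriv (d_dx_y r n) z / dx r z)"
  by (cases n) (auto simp: d_dx_y_def d_dx_def)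

lemma d_dx_y_holomorphic:
  assumes "r \<ge> 1" "n \<ge> 1"
  shows "d_dx_y r n holomorphic_on - curve_pts r"
  using assms(2)
proof (induction n rule: nat_induct_at_least)
  case base
  have "dy r holomorphic_on - curve_pts r" "dx r holomorphic_on - curve_pts r"
    by (rule holomorphic_on_subset[OF dy_holomorphic] holomorphic_on_subset[OF dx_holomorphic],
        auto simp: curve_pts_def)+
  then show ?case unfolding d_dx_y_def
    using dx_nonzero[OF assms(1)] by (auto intro!: holomorphic_intros simp: curve_pts_def)
next
  case (Suc n)
  have "dx r holomorphic_on - curve_pts r"
    by (rule holomorphic_on_subset[OF dx_holomorphic]) (auto simp: curve_pts_def)
  then show ?case unfolding d_dx_y_Suc_eq[OF Suc.hyps]
    using dx_nonzero[OF assms(1)] Suc.IH open_Compl_curve_pts[OF assms(1), of "{}"]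
    by (auto intro!: holomorphic_intros holomorphic_deriv simp: curve_pts_def)
qed

text \<open>Holomorphy off the special points leaves essential singularities possible; the Laurent
  expansions in the reciprocity argument need meromorphy.\<close>

lemma d_dx_y_meromorphic: "n \<ge> 1 \<Longrightarrow> d_dx_y r n meromorphic_on UNIV"
proof (induction n rule: nat_induct_at_least)
  case base
  show ?case unfolding d_dx_y_def dy_def dx_def by (auto intro!: meromorphic_intros)
next
  case (Suc n)
  show ?case unfolding d_dx_y_Suc_eq[OF Suc.hyps] dx_def
    by (intro meromorphic_intros Suc.IH)
qed

text \<open>\<open>dy\<close> is the logarithmic derivative of \<open>1 + z ^ r\<close>, which has
  simple zeros, so its residue at \<open>a\<close> is 1 and the product picks out the value of
  \<open>g\<close>.\<close>

lemma residue_dy_times: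
  assumes "r \<ge> 1" "a \<in> y_poles r" "open S" "a \<in> S" "g holomorphic_on S"
  shows "residue (\<lambda>z. dy r z * g z) a = g a"
proof -
  have "a \<noteq> 0" using assms zero_notin_y_poles by blast
  define U where "U = S \<inter> - (y_poles r - {a})"
  have U: "open U" "a \<in> U" "U - {a} \<subseteq> - y_poles r" "U - {a} \<subseteq> S"
  proof -
    show "open U" unfolding U_def
      by (intro open_Int open_Compl finite_imp_closed finite_Diff finite_y_poles assms)
  qed (use assms in \<open>auto simp: U_def\<close>)
  show ?thesis
  proof (rule residue_simple'[OF U(1,2)])
    show "(\<lambda>z. dy r z * g z) holomorphic_on U - {a}"
      by (rule holomorphic_on_mult[OF holomorphic_on_subset[OF dy_holomorphic U(3)]
          holomorphic_on_subset[OF assms(5) U(4)]])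
    have "g field_differentiable at a"
      by (rule holomorphic_on_imp_differentiable_at[OF assms(5,3,4)])
    then have g: "isCont g a" by (rule field_differentiable_imp_continuous_at)
    have nz: "of_nat r * a ^ (r - 1) \<noteq> (0::complex)" using \<open>a \<noteq> 0\<close> assms(1) by simp
    have "((\<lambda>z. 1 + z ^ r) has_field_derivative of_nat r * a ^ (r - 1)) (at a)"
      by (auto intro!: derivative_eq_intros)
    moreover have a: "1 + a ^ r = 0" using assms(2) by (simp add: y_poles_def)
    ultimately have lim: "((\<lambda>z. (1 + z ^ r) / (z - a)) \<longlongrightarrow> of_nat r * a ^ (r - 1)) (at a)"
      by (simp add: has_field_derivative_iff)
    have "((\<lambda>z. of_nat r * z ^ (r - 1) * g z / ((1 + z ^ r) / (z - a)))
        \<longlongrightarrow> of_nat r * a ^ (r - 1) * g a / (of_nat r * a ^ (r - 1))) (at a)"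
      by (intro tendsto_intros lim nz isContD[OF g])
    also have "of_nat r * a ^ (r - 1) * g a / (of_nat r * a ^ (r - 1)) = g a"
      using nz by simp
    finally show "((\<lambda>z. dy r z * g z * (z - a)) \<longlongrightarrow> g a) (at a)"
      by (simp add: dy_def mult_ac)
  qed
qed

text \<open>Because \<open>\<partial>\<^sub>x\<close> maps \<xi> of index \<open>m\<close> to
  \<open>r\<close> times \<xi> of index \<open>m + 1\<close>, each integration by parts takes one
  derivative off \<open>y\<close>, raises the index by one and costs a factor \<open>- r\<close>.
  The final value depends on \<open>a\<close> only through \<open>a ^ r = -1\<close>.\<close>

lemma residue_d_dx_y:
  assumes r: "r \<ge> 1" and a: "a \<in> y_poles r" and "n \<ge> 1"
  shows "residue (\<lambda>z. d_dx_y r n z * dx r z * xi_rat r m (z ^ r)) a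
    = (- of_nat r) ^ (n - 1) * xi_rat r (m + (n - 1)) (-1)"
  using assms(3)
proof (induction n arbitrary: m rule: nat_induct_at_least)
  case base
  define S where "S = - (curve_pts r - {a})"
  have S: "open S" "a \<in> S" "S \<subseteq> - insert 0 (branch_pts r)"
    using open_Compl_curve_pts[OF r, of "{a}"] a y_poles_branch_pts_disjoint[OF a] zero_notin_y_poles[OF r]
    by (auto simp: S_def curve_pts_def)
  have "residue (\<lambda>z. d_dx_y r 1 z * dx r z * xi_rat r m (z ^ r)) a = residue (\<lambda>z. dy r z * xi_rat r m (z ^ r)) a"
  proof (rule residue_cong)
    have "eventually (\<lambda>z. z \<in> S) (at a)" using S by (intro eventually_at_in_open')
    then show "\<forall>\<^sub>F z in at a. d_dx_y r 1 z * dx r z * xi_rat r m (z ^ r) = dy r z * xi_rat r m (z ^ r)"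
    proof eventually_elim
      case (elim z)
      then show ?case using d_dx_y_1[OF r, of z] S by auto
    qed
  qed simp
  also have "\<dots> = xi_rat r m (a ^ r)"
    by (rule residue_dy_times[OF r a S(1,2)])
       (use S in \<open>auto intro: holomorphic_on_subset[OF xi_rat_power_holomorphic]\<close>)
  finally show ?case using a by (simp add: y_poles_def)
next
  case (Suc n)
  define S where "S = - (curve_pts r - {a})"
  have S: "open S" "a \<in> S" "S - {a} = - curve_pts r" "S - {a} \<subseteq> - insert 0 (branch_pts r)"
      "S - {a} \<subseteq> - branch_pts r"
    using open_Compl_curve_pts[OF r, of "{a}"] a by (auto simp: S_def curve_pts_def)
  have ev: "eventually (\<lambda>z. z \<in> S - {a}) (at a)" using S by (intro eventually_at_in_open)
  let ?\<xi> = "\<lambda>m z. xi_rat r m (z ^ r)"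
  have \<xi>: "?\<xi> m holomorphic_on S - {a}" for m
    by (rule holomorphic_on_subset[OF xi_rat_power_holomorphic]) (use S in auto)
  have d: "d_dx_y r n holomorphic_on S - {a}"
    unfolding S by (rule d_dx_y_holomorphic[OF r Suc.hyps])
  have dxh: "dx r holomorphic_on S - {a}"
    by (rule holomorphic_on_subset[OF dx_holomorphic]) (use S in auto)
  have "residue (\<lambda>z. d_dx_y r (Suc n) z * dx r z * ?\<xi> m z) a = residue (\<lambda>z. deriv (d_dx_y r n) z * ?\<xi> m z) a"
  proof (rule residue_cong)
    show "\<forall>\<^sub>F z in at a. d_dx_y r (Suc n) z * dx r z * ?\<xi> m z = deriv (d_dx_y r n) z * ?\<xi> m z"
      using ev
    proof eventually_elim
      case (elim z)
      then show ?case using d_dx_y_Suc[OF r _ Suc.hyps, of z] S by auto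
    qed
  qed simp
  also have "\<dots> = - residue (\<lambda>z. d_dx_y r n z * deriv (?\<xi> m) z) a"
    using residue_by_parts[OF S(1,2) d \<xi>] by simp
  also have "residue (\<lambda>z. d_dx_y r n z * deriv (?\<xi> m) z) a
      = residue (\<lambda>z. of_nat r * (d_dx_y r n z * dx r z * ?\<xi> (Suc m) z)) a"
  proof (rule residue_cong)
    show "\<forall>\<^sub>F z in at a. d_dx_y r n z * deriv (?\<xi> m) z = of_nat r * (d_dx_y r n z * dx r z * ?\<xi> (Suc m) z)"
      using ev
    proof eventually_elim
      case (elim z)
      then have "deriv (?\<xi> m) z = of_nat r * dx r z * ?\<xi> (Suc m) z"
        using S by (intro DERIV_imp_deriv xi_rat_power_has_derivative r) auto
      then show ?case by simp
    qed
  qed simp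
  also have "\<dots> = of_nat r * residue (\<lambda>z. d_dx_y r n z * dx r z * ?\<xi> (Suc m) z) a"
    by (rule residue_lmul[OF S(1,2)]) (intro holomorphic_intros d dxh \<xi>)
  also have "\<dots> = of_nat r * ((- of_nat r) ^ (n - 1) * xi_rat r (Suc m + (n - 1)) (-1))"
    by (simp only: Suc.IH)
  finally show ?case using Suc.hyps by (cases n) auto
qed

text \<open>For \<open>n \<ge> 2\<close> the form \<open>\<partial>\<^sub>x\<^sup>n y dx\<close> is
  the differential of the single-valued \<open>d_dx_y r (n - 1)\<close> and has no residue at
  \<open>a\<close>, so \<open>1 / (z - t)\<close> may serve as the primitive of
  \<open>B_kernel t z\<close>. For \<open>n = 1\<close> the form is \<open>dy\<close>, whose residue
  is 1.\<close>

lemma Phi_eq: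
  assumes r: "r \<ge> 1" and n: "n \<ge> 2" and z: "z \<notin> y_poles r"
  shows "Phi r n z = (\<Sum>a\<in>y_poles r.
    residue (\<lambda>t. fps_nth (inverse S_fps) n * d_dx_y r n t * dx r t * (1 / (z - t))) a)"
proof -
  let ?c = "fps_nth (inverse S_fps) n"
  have "res_primitive (\<lambda>t. ?c * d_dx_y r n t * dx r t) (\<lambda>t. B_kernel t z) a
      = residue (\<lambda>t. ?c * d_dx_y r n t * dx r t * (1 / (z - t))) a" if a: "a \<in> y_poles r" for a
  proof -
    define S where "S = - (curve_pts r - {a}) \<inter> - {z}"
    have S: "open S" "a \<in> S" "S - {a} \<subseteq> - curve_pts r" "S - {a} \<subseteq> - insert 0 (branch_pts r)" "z \<notin> S"
      using open_Compl_curve_pts[OF r, of "{a}"] a z by (auto simp: S_def curve_pts_def)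
    have hol: "d_dx_y r k holomorphic_on S - {a}" if "k \<ge> 1" for k
      by (rule holomorphic_on_subset[OF d_dx_y_holomorphic[OF r that] S(3)])
    have dxh: "dx r holomorphic_on S - {a}"
      by (rule holomorphic_on_subset[OF dx_holomorphic]) (use S in auto)
    have \<mu>h: "(\<lambda>t. ?c * d_dx_y r n t * dx r t) holomorphic_on S - {a}"
      using n by (intro holomorphic_intros hol dxh) auto
    obtain k where k: "n = Suc k" "k \<ge> 1" using n by (cases n) auto
    have "residue (\<lambda>t. ?c * d_dx_y r n t * dx r t) a = residue (\<lambda>t. ?c * deriv (d_dx_y r k) t) a"
    proof (rule residue_cong)
      have "eventually (\<lambda>z. z \<in> S - {a}) (at a)" using S by (intro eventually_at_in_open)
      then show "\<forall>\<^sub>F t in at a. ?c * d_dx_y r n t * dx r t = ?c * deriv (d_dx_y r k) t"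
      proof eventually_elim
        case (elim t)
        then show ?case using d_dx_y_Suc[OF r _ k(2), of t] S k by auto
      qed
    qed simp
    also have "\<dots> = ?c * residue (deriv (d_dx_y r k)) a"
      using S hol[OF k(2)] by (intro residue_lmul[of S] holomorphic_deriv) auto
    also have "residue (deriv (d_dx_y r k)) a = 0"
      by (rule residue_deriv_eq_0[OF S(1,2) hol[OF k(2)]])
    finally have "residue (\<lambda>t. ?c * d_dx_y r n t * dx r t) a = 0" by simp
    then show ?thesis
    proof (intro res_primitive_eq[OF S(1,2) \<mu>h])
      fix t assume "t \<in> S - {a}"
      then have "t \<noteq> z" using S by auto
      then show "((\<lambda>t. 1 / (z - t)) has_field_derivative B_kernel t z) (at t)"
        by (auto intro!: derivative_eq_intros simp: B_kernel_def power2_eq_square field_simps)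
    qed
  qed
  then show ?thesis using n by (simp add: Phi_def y_poles_def)
qed

lemma f_ser_nth_ge_2:
  assumes r: "r \<ge> 1" and n: "n \<ge> 2"
  shows "fps_nth (f_ser r k) n = fps_nth (inverse S_fps) n * of_nat r * (- of_nat r) ^ (n - 1)
    * xi_rat r (k + (n - 1)) (-1)"
proof -
  let ?c = "fps_nth (inverse S_fps) n"
  let ?G = "\<lambda>t. ?c * d_dx_y r n t * dx r t"
  let ?\<xi> = "\<lambda>z. xi_rat r k (z ^ r)"
  \<comment> \<open>The principal part of \<open>?G\<close> at \<open>a\<close>, so that
    \<open>Phi r n\<close> is a sum of functions holomorphic at the branch points.\<close>
  let ?R = "\<lambda>a z. residue (\<lambda>t. ?G t * (1 / (z - t))) a"
  have G: "?G meromorphic_on {a}" for a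
    using n unfolding dx_def
    by (intro meromorphic_intros meromorphic_on_subset[OF d_dx_y_meromorphic]) auto
  have R: "?R a holomorphic_on - {a}" for a by (rule holomorphic_residue_cauchy_kernel[OF G])
  have q: "res_primitive (deriv (xi_fun r k)) (Phi r n) q
      = - (\<Sum>a\<in>y_poles r. residue (\<lambda>z. ?\<xi> z * ?R a z) q)" if q: "q \<in> branch_pts r" for q
  proof -
    define S where "S = - (curve_pts r - {q})"
    have S: "open S" "q \<in> S" "S \<subseteq> - y_poles r" "S - {q} \<subseteq> - insert 0 (branch_pts r)"
      using open_Compl_curve_pts[OF r, of "{q}"] q y_poles_branch_pts_disjoint by (auto simp: S_def curve_pts_def)
    have Rh: "?R a holomorphic_on S" if "a \<in> y_poles r" for a
      by (rule holomorphic_on_subset[OF R]) (use S that in auto)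
    have \<Phi>: "Phi r n holomorphic_on S"
    proof (rule holomorphic_transform)
      show "(\<lambda>z. \<Sum>a\<in>y_poles r. ?R a z) holomorphic_on S" by (intro holomorphic_intros Rh)
    qed (use S in \<open>auto simp: Phi_eq[OF r n]\<close>)
    have \<xi>h: "?\<xi> holomorphic_on S - {q}"
      by (rule holomorphic_on_subset[OF xi_rat_power_holomorphic]) (use S in auto)
    have "res_primitive (deriv (xi_fun r k)) (Phi r n) q = - residue (\<lambda>z. xi_fun r k z * Phi r n z) q"
      by (rule res_primitive_deriv[OF S(1,2) holomorphic_on_subset[OF xi_fun_holomorphic[OF r] S(4)] \<Phi>])
    also have "residue (\<lambda>z. xi_fun r k z * Phi r n z) q = residue (\<lambda>z. \<Sum>a\<in>y_poles r. ?\<xi> z * ?R a z) q"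
    proof (rule residue_cong)
      have "eventually (\<lambda>z. z \<in> S - {q}) (at q)" using S by (intro eventually_at_in_open)
      then show "\<forall>\<^sub>F z in at q. xi_fun r k z * Phi r n z = (\<Sum>a\<in>y_poles r. ?\<xi> z * ?R a z)"
      proof eventually_elim
        case (elim z)
        then have "z \<notin> insert 0 (branch_pts r)" "z \<notin> y_poles r" using S by auto
        then show ?case by (simp only: xi_fun_eq[OF r] Phi_eq[OF r n] sum_distrib_left not_False_eq_True)
      qed
    qed simp
    also have "\<dots> = (\<Sum>a\<in>y_poles r. residue (\<lambda>z. ?\<xi> z * ?R a z) q)"
      by (rule residue_sum[OF S(1,2)]) (intro holomorphic_on_mult \<xi>h holomorphic_on_subset[OF Rh], auto)
    finally show ?thesis .
  qed
  \<comment> \<open>For fixed \<open>a\<close>, reciprocity exchanges all branch points for the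
    single pole \<open>a\<close>.\<close>
  have a: "(\<Sum>q\<in>branch_pts r. residue (\<lambda>z. ?\<xi> z * ?R a z) q) =
      - (?c * ((- of_nat r) ^ (n - 1) * xi_rat r (k + (n - 1)) (-1)))" if a: "a \<in> y_poles r" for a
  proof -
    define S where "S = - (curve_pts r - {a})"
    have S: "open S" "a \<in> S" "S - {a} = - curve_pts r"
      using open_Compl_curve_pts[OF r, of "{a}"] a by (auto simp: S_def curve_pts_def)
    have hol: "(\<lambda>z. d_dx_y r n z * dx r z * ?\<xi> z) holomorphic_on S - {a}"
      unfolding S using n
      by (intro holomorphic_intros d_dx_y_holomorphic r holomorphic_on_subset[OF dx_holomorphic]
          holomorphic_on_subset[OF xi_rat_power_holomorphic]) (auto simp: curve_pts_def)
    have "(\<Sum>q\<in>branch_pts r. residue (\<lambda>z. ?\<xi> z * ?R a z) q) = - residue (\<lambda>z. ?G z * ?\<xi> z) a"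
      by (rule sum_residue_reciprocity)
         (use finite_branch_pts[OF r] y_poles_branch_pts_disjoint[OF a] xi_rat_power_holomorphic
            xi_rat_power_tendsto_0[OF r] G in auto)
    also have "residue (\<lambda>z. ?G z * ?\<xi> z) a = ?c * residue (\<lambda>z. d_dx_y r n z * dx r z * ?\<xi> z) a"
      using residue_lmul[OF S(1,2) hol, of ?c] by (simp add: mult.assoc)
    also have "residue (\<lambda>z. d_dx_y r n z * dx r z * ?\<xi> z) a = (- of_nat r) ^ (n - 1) * xi_rat r (k + (n - 1)) (-1)"
      using n by (intro residue_d_dx_y[OF r a]) auto
    finally show ?thesis .
  qed
  have "fps_nth (f_ser r k) n = (\<Sum>q\<in>branch_pts r. res_primitive (deriv (xi_fun r k)) (Phi r n) q)"
    by (simp add: f_ser_def pairing_def branch_pts_def)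
  \<comment> \<open>This sign comes from integrating by parts and cancels the one from reciprocity.
    The \<open>r\<close> poles then contribute equally, which gives the factor
    \<open>of_nat r\<close>.\<close>
  also have "\<dots> = - (\<Sum>q\<in>branch_pts r. \<Sum>a\<in>y_poles r. residue (\<lambda>z. ?\<xi> z * ?R a z) q)"
    by (simp only: q sum_negf cong: sum.cong)
  also have "\<dots> = - (\<Sum>a\<in>y_poles r. \<Sum>q\<in>branch_pts r. residue (\<lambda>z. ?\<xi> z * ?R a z) q)"
    by (subst sum.swap) simp
  also have "\<dots> = (\<Sum>a\<in>y_poles r. ?c * ((- of_nat r) ^ (n - 1) * xi_rat r (k + (n - 1)) (-1)))"
    by (simp only: a sum_negf minus_minus cong: sum.cong)
  also have "\<dots> = of_nat r * (?c * ((- of_nat r) ^ (n - 1) * xi_rat r (k + (n - 1)) (-1)))"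
    using card_y_poles[OF r] by simp
  finally show ?thesis by (simp add: mult_ac)
qed

text \<open>For index 0 the integrand is holomorphic at the branch points. For higher index,
  integration by parts turns \<open>Y\<close> into its rational derivative, and the residue theorem
  moves the residues to the poles of \<open>dy\<close> and to infinity.\<close>

lemma f_ser_nth_0:
  assumes r: "r \<ge> 1"
  shows "fps_nth (f_ser r 0) 0 = 0"
    and "fps_nth (f_ser r (Suc j)) 0 = (if j = 0 then 1 / of_nat r else 0) - xi_rat r j (-1)"
proof -
  define Y where "Y = (\<lambda>z. y_fun r z - z ^ r)"
  let ?\<xi> = "\<lambda>k z. xi_rat r k (z ^ r)"
  \<comment> \<open>The branch cut of \<open>Ln (1 + z ^ r)\<close> is removed too. It misses
    \<open>q\<close>, since \<open>1 + q ^ r = 1 + 1 / r\<close> is positive.\<close>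
  define S where "S = (\<lambda>q. - (curve_pts r - {q}) \<inter> - ((\<lambda>z. 1 + z ^ r) -` \<real>\<^sub>\<le>\<^sub>0))"
  have S: "open (S q)" "q \<in> S q" "S q \<subseteq> - insert 0 (y_poles r)" "S q - {q} \<subseteq> - insert 0 (branch_pts r)"
      "0 \<notin> S q" if q: "q \<in> branch_pts r" for q
  proof -
    have "closed ((\<lambda>z::complex. 1 + z ^ r) -` \<real>\<^sub>\<le>\<^sub>0)"
      by (intro continuous_closed_vimage closed_nonpos_Reals_complex continuous_intros)
    then show "open (S q)" unfolding S_def by (intro open_Int open_Compl_curve_pts r) auto
    have "q ^ r = of_real (1 / of_nat r)" using q r by (auto simp: branch_pts_def field_simps)
    then have "1 + q ^ r = of_real (1 + 1 / of_nat r)" by simp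
    moreover have "1 + 1 / real r > 0" by (simp add: add_pos_nonneg)
    ultimately have "1 + q ^ r \<notin> \<real>\<^sub>\<le>\<^sub>0" by (metis nonpos_Reals_of_real_iff not_le)
    then show "q \<in> S q" by (simp add: S_def)
  qed (use that y_poles_branch_pts_disjoint zero_notin_branch_pts[OF r] in \<open>auto simp: S_def curve_pts_def\<close>)
  have Yd: "(Y has_field_derivative dy r z - of_nat r * z ^ (r - 1)) (at z)" if "z \<in> S q" for z q
    unfolding Y_def using that
    by (intro DERIV_diff y_fun_has_derivative) (auto simp: S_def intro!: derivative_eq_intros)
  have Yh: "Y holomorphic_on S q" if "q \<in> branch_pts r" for q
    using Yd S(1)[OF that] by (auto simp: holomorphic_on_open)
  have q: "res_primitive (deriv (xi_fun r k)) (Phi r 0) q = - residue (\<lambda>z. ?\<xi> k z * dx r z * Y z) q"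
    if q: "q \<in> branch_pts r" for q k
  proof -
    note S = S[OF q]
    have "Phi r 0 holomorphic_on S q"
    proof (rule holomorphic_transform)
      show "(\<lambda>z. Y z * dx r z) holomorphic_on S q"
        by (intro holomorphic_intros Yh[OF q] holomorphic_on_subset[OF dx_holomorphic]) (use S in auto)
    qed (simp add: Phi_def Y_def)
    then have "res_primitive (deriv (xi_fun r k)) (Phi r 0) q = - residue (\<lambda>z. xi_fun r k z * Phi r 0 z) q"
      by (rule res_primitive_deriv[OF S(1,2) holomorphic_on_subset[OF xi_fun_holomorphic[OF r] S(4)]])
    also have "residue (\<lambda>z. xi_fun r k z * Phi r 0 z) q = residue (\<lambda>z. ?\<xi> k z * dx r z * Y z) q"
    proof (rule residue_cong)
      have "eventually (\<lambda>z. z \<in> S q - {q}) (at q)" using S by (intro eventually_at_in_open)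
      then show "\<forall>\<^sub>F z in at q. xi_fun r k z * Phi r 0 z = ?\<xi> k z * dx r z * Y z"
      proof eventually_elim
        case (elim z)
        then have "z \<notin> insert 0 (branch_pts r)" using S by blast
        then show ?case by (simp add: xi_fun_eq[OF r] Phi_def Y_def)
      qed
    qed simp
    finally show ?thesis .
  qed
  have f: "fps_nth (f_ser r k) 0 = - (\<Sum>q\<in>branch_pts r. residue (\<lambda>z. ?\<xi> k z * dx r z * Y z) q)" for k
    using q by (simp add: f_ser_def pairing_def sum_negf flip: branch_pts_def)

  have "residue (\<lambda>z. ?\<xi> 0 z * dx r z * Y z) q = 0" if q: "q \<in> branch_pts r" for q
  proof -
    note S = S[OF q]
    \<comment> \<open>The zeros of \<open>dx\<close> cancel the poles of \<xi> of index 0: their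
      product is \<open>1 / z\<close>.\<close>
    have "residue (\<lambda>z. ?\<xi> 0 z * dx r z * Y z) q = residue (\<lambda>z. Y z / z) q"
    proof (rule residue_cong)
      have "eventually (\<lambda>z. z \<in> S q - {q}) (at q)" using S by (intro eventually_at_in_open)
      then show "\<forall>\<^sub>F z in at q. ?\<xi> 0 z * dx r z * Y z = Y z / z"
      proof eventually_elim
        case (elim z)
        then have "z \<notin> insert 0 (branch_pts r)" using S by blast
        then show ?case using r by (simp add: xi_rat_def dx_eq branch_pts_def)
      qed
    qed simp
    also have "\<dots> = 0"
      by (rule residue_holo[OF S(1,2)]) (intro holomorphic_intros Yh[OF q], use S in auto)
    finally show ?thesis .
  qed
  then show "fps_nth (f_ser r 0) 0 = 0" by (simp add: f)

  define T where "T = (\<lambda>z. (dy r z - of_nat r * z ^ (r - 1)) * ?\<xi> j z)"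
  \<comment> \<open>The limit of \<open>z * T z\<close> at infinity, that is, minus the residue of
    \<open>T\<close> at infinity.\<close>
  define L :: complex where "L = (if j = 0 then 1 else 0)"
  have Th: "T holomorphic_on - (branch_pts r \<union> y_poles r)" unfolding T_def
    by (intro holomorphic_intros holomorphic_on_subset[OF dy_holomorphic]
        holomorphic_on_subset[OF xi_rat_power_holomorphic]) auto
  have Tq: "residue (\<lambda>z. ?\<xi> (Suc j) z * dx r z * Y z) q = - (residue T q / of_nat r)"
    if q: "q \<in> branch_pts r" for q
  proof -
    note S = S[OF q]
    have ev: "eventually (\<lambda>z. z \<in> S q - {q}) (at q)" using S by (intro eventually_at_in_open)
    have \<xi>h: "?\<xi> j holomorphic_on S q - {q}"
      by (rule holomorphic_on_subset[OF xi_rat_power_holomorphic]) (use S in auto)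
    have Yh': "Y holomorphic_on S q - {q}" by (rule holomorphic_on_subset[OF Yh[OF q]]) auto
    have "residue (\<lambda>z. ?\<xi> (Suc j) z * dx r z * Y z) q = residue (\<lambda>z. (Y z * deriv (?\<xi> j) z) / of_nat r) q"
    proof (rule residue_cong)
      show "\<forall>\<^sub>F z in at q. ?\<xi> (Suc j) z * dx r z * Y z = (Y z * deriv (?\<xi> j) z) / of_nat r"
        using ev
      proof eventually_elim
        case (elim z)
        then have "z \<notin> insert 0 (branch_pts r)" using S by blast
        from DERIV_imp_deriv[OF xi_rat_power_has_derivative[OF r this]] show ?case using r by simp
      qed
    qed simp
    also have "\<dots> = residue (\<lambda>z. Y z * deriv (?\<xi> j) z) q / of_nat r"
      by (rule residue_div[OF S(1,2)]) (intro holomorphic_intros holomorphic_deriv \<xi>h Yh', use S in auto)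
    also have "residue (\<lambda>z. Y z * deriv (?\<xi> j) z) q = - residue (\<lambda>z. deriv Y z * ?\<xi> j z) q"
      by (rule residue_by_parts[OF S(1,2) Yh' \<xi>h])
    also have "residue (\<lambda>z. deriv Y z * ?\<xi> j z) q = residue T q"
    proof (rule residue_cong)
      show "\<forall>\<^sub>F z in at q. deriv Y z * ?\<xi> j z = T z"
        using ev
      proof eventually_elim
        case (elim z)
        then have "deriv Y z = dy r z - of_nat r * z ^ (r - 1)" by (intro DERIV_imp_deriv Yd) auto
        then show ?case by (simp add: T_def)
      qed
    qed simp
    finally show ?thesis by simp
  qed
  have Ta: "residue T a = xi_rat r j (-1)" if a: "a \<in> y_poles r" for a
  proof -
    define U where "U = - (curve_pts r - {a})"
    have U: "open U" "a \<in> U" "U \<subseteq> - branch_pts r" "U - {a} \<subseteq> - y_poles r"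
      using open_Compl_curve_pts[OF r, of "{a}"] a y_poles_branch_pts_disjoint[OF a]
      by (auto simp: U_def curve_pts_def)
    have \<xi>h: "?\<xi> j holomorphic_on U"
      by (rule holomorphic_on_subset[OF xi_rat_power_holomorphic]) (use U in auto)
    have "residue T a = residue (\<lambda>z. dy r z * ?\<xi> j z - of_nat r * z ^ (r - 1) * ?\<xi> j z) a"
      by (simp add: T_def left_diff_distrib)
    also have "\<dots> = residue (\<lambda>z. dy r z * ?\<xi> j z) a - residue (\<lambda>z. of_nat r * z ^ (r - 1) * ?\<xi> j z) a"
      by (rule residue_diff[OF U(1,2)])
        (intro holomorphic_intros holomorphic_on_subset[OF dy_holomorphic] holomorphic_on_subset[OF \<xi>h]; use U in auto)+
    also have "residue (\<lambda>z. of_nat r * z ^ (r - 1) * ?\<xi> j z) a = 0"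
      by (rule residue_holo[OF U(1,2)]) (intro holomorphic_intros \<xi>h)
    also have "residue (\<lambda>z. dy r z * ?\<xi> j z) a = ?\<xi> j a"
      by (rule residue_dy_times[OF r a U(1,2) \<xi>h])
    finally show ?thesis using a by (simp add: y_poles_def)
  qed
  \<comment> \<open>This is \<open>z * T z\<close> in the coordinate \<open>Z\<close>, with
    \<open>r Z / (1 + Z)\<close> written as \<open>r - r / (Z + 1)\<close>. Only the last product
    can have a nonzero limit; for \<open>j = 0\<close> it equals \<xi> of index 0 minus 1 and tends
    to -1.\<close>
  have "((\<lambda>Z. (of_nat r - of_nat r * (1 / (Z - (-1)))) * xi_rat r j Z - of_nat r * (Z * xi_rat r j Z))
      \<longlongrightarrow> (of_nat r - of_nat r * 0) * 0 - (- L)) at_infinity"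
  proof (intro tendsto_intros tendsto_inverse_diff_at_infinity xi_rat_tendsto_0[OF r])
    show "((\<lambda>Z. of_nat r * (Z * xi_rat r j Z)) \<longlongrightarrow> - L) at_infinity"
    proof (cases "j = 0")
      case True
      have "((\<lambda>Z. xi_rat r 0 Z - 1) \<longlongrightarrow> 0 - 1) at_infinity"
        by (intro tendsto_intros xi_rat_tendsto_0[OF r])
      moreover have "eventually (\<lambda>Z. Z \<noteq> 1 / of_nat r) at_infinity"
        by (rule eventually_not_equal_at_infinity)
      then have "\<forall>\<^sub>F Z in at_infinity. xi_rat r 0 Z - 1 = of_nat r * (Z * xi_rat r 0 Z)"
      proof eventually_elim
        case (elim Z)
        then have "of_nat r * Z \<noteq> 1" using r by (auto simp: field_simps)
        then show ?case by (simp add: xi_rat_def field_simps)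
      qed
      ultimately have "((\<lambda>Z. of_nat r * (Z * xi_rat r 0 Z)) \<longlongrightarrow> 0 - 1) at_infinity"
        by (rule Lim_transform_eventually)
      then show ?thesis using True by (simp add: L_def)
    next
      case False
      have "((\<lambda>Z. of_nat r * (Z * xi_rat r j Z)) \<longlongrightarrow> of_nat r * 0) at_infinity"
        by (intro tendsto_intros xi_rat_mult_tendsto_0[OF r]) (use False in auto)
      then show ?thesis using False by (simp add: L_def)
    qed
  qed
  from filterlim_compose[OF this filterlim_power_at_infinity_complex[OF r]]
  have "((\<lambda>z. (of_nat r - of_nat r * (1 / (z ^ r + 1))) * ?\<xi> j z - of_nat r * (z ^ r * ?\<xi> j z)) \<longlongrightarrow> L) at_infinity"
    by simp
  moreover have "eventually (\<lambda>z. z \<notin> y_poles r) at_infinity"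
    using finite_y_poles[OF r] by (simp add: eventually_at_infinity) 
      (metis bounded_pos finite_imp_bounded gt_ex order.strict_trans1 not_le)
  then have "\<forall>\<^sub>F z in at_infinity. (of_nat r - of_nat r * (1 / (z ^ r + 1))) * ?\<xi> j z - of_nat r * (z ^ r * ?\<xi> j z) = z * T z"
  proof eventually_elim
    case (elim z)
    then have "1 + z ^ r \<noteq> 0" by (auto simp: y_poles_def add_eq_0_iff)
    moreover have "z ^ r = z * z ^ (r - 1)" using r by (cases r) auto
    ultimately show ?case by (simp add: T_def dy_def field_simps)
  qed
  ultimately have "((\<lambda>z. z * T z) \<longlongrightarrow> L) at_infinity" by (rule Lim_transform_eventually)
  then have "(\<Sum>p\<in>branch_pts r \<union> y_poles r. residue T p) = L"
    using finite_branch_pts[OF r] finite_y_poles[OF r]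
    by (intro sum_residues_eq_limit) (use Th in auto)
  moreover have "(\<Sum>p\<in>branch_pts r \<union> y_poles r. residue T p)
      = (\<Sum>p\<in>branch_pts r. residue T p) + (\<Sum>p\<in>y_poles r. residue T p)"
    using y_poles_branch_pts_disjoint finite_branch_pts[OF r] finite_y_poles[OF r]
    by (intro sum.union_disjoint) auto
  moreover have "(\<Sum>p\<in>y_poles r. residue T p) = of_nat r * xi_rat r j (-1)"
    using Ta card_y_poles[OF r] by simp
  ultimately have "(\<Sum>p\<in>branch_pts r. residue T p) = L - of_nat r * xi_rat r j (-1)"
    by (simp add: algebra_simps)
  then have "fps_nth (f_ser r (Suc j)) 0 = (L - of_nat r * xi_rat r j (-1)) / of_nat r"
    by (simp add: f Tq sum_negf flip: sum_divide_distrib)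
  then show "fps_nth (f_ser r (Suc j)) 0 = (if j = 0 then 1 / of_nat r else 0) - xi_rat r j (-1)"
    using r by (simp add: L_def diff_divide_distrib)
qed

text \<open>The coefficient of 1/S kills \<open>Phi r 1\<close>. The primitive chosen for the zero
  differential may still be a nonzero constant near \<open>q\<close>, which does not contribute
  because an exact differential has no residue.\<close>

lemma f_ser_nth_1:
  assumes r: "r \<ge> 1" and c: "fps_nth (inverse S_fps) 1 = 0"
  shows "fps_nth (f_ser r k) 1 = 0"
proof -
  have "Phi r 1 = (\<lambda>_. 0)" using c by (simp add: Phi_def res_primitive_def residue_const)
  moreover have "res_primitive (deriv (xi_fun r k)) (\<lambda>_. 0) q = 0" if q: "q \<in> branch_pts r" for q
  proof -
    define S where "S = - (curve_pts r - {q})"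
    have S: "open S" "q \<in> S" "S - {q} \<subseteq> - insert 0 (branch_pts r)"
      using open_Compl_curve_pts[OF r, of "{q}"] q by (auto simp: S_def curve_pts_def)
    show ?thesis
      using res_primitive_deriv[OF S(1,2) holomorphic_on_subset[OF xi_fun_holomorphic[OF r] S(3)], where \<nu> = "\<lambda>_. 0"]
      by (simp add: residue_const)
  qed
  ultimately show ?thesis by (simp add: f_ser_def pairing_def flip: branch_pts_def)
qed

section \<open>Evaluation at the root of a power series\<close>

definition ring_map :: "('a::comm_ring_1 \<Rightarrow> 'b::comm_ring_1) \<Rightarrow> bool" where
  "ring_map f \<longleftrightarrow> f 1 = 1 \<and> (\<forall>x y. f (x + y) = f x + f y) \<and> (\<forall>x y. f (x * y) = f x * f y)"

lemma ring_mapD: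
  assumes "ring_map f"
  shows "f 1 = 1" "f (x + y) = f x + f y" "f (x * y) = f x * f y" "f 0 = 0" "f (- x) = - f x"
    "f (x - y) = f x - f y" "f (sum g A) = (\<Sum>a\<in>A. f (g a))" "f (x ^ n) = f x ^ n"
proof -
  show *: "f 1 = 1" "f (x + y) = f x + f y" "f (x * y) = f x * f y" for x y
    using assms by (auto simp: ring_map_def)
  show 0: "f 0 = 0" using *(2)[of 0 0] by simp
  show m: "f (- x) = - f x" for x using *(2)[of x "- x"] 0 by (simp add: eq_neg_iff_add_eq_0 add.commute)
  show "f (x - y) = f x - f y" using *(2)[of x "- y"] m by simp
  show "f (sum g A) = (\<Sum>a\<in>A. f (g a))" by (induction A rule: infinite_finite_induct) (auto simp: 0 *)
  show "f (x ^ n) = f x ^ n" by (induction n) (auto simp: *)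
qed

lemma fps_map_nth [simp]: "fps_nth (fps_map f F) n = f (fps_nth F n)"
  by (simp add: fps_map_def)

lemma fps_map_compose: "fps_map f (fps_map g F) = fps_map (\<lambda>x. f (g x)) F"
  by (rule fps_ext) simp

lemma ring_map_fps_map:
  assumes "ring_map f"
  shows "ring_map (fps_map f)"
  unfolding ring_map_def
  by (auto simp: fps_eq_iff fps_mult_nth ring_mapD[OF assms])

lemma fps_map_fps_const: "ring_map f \<Longrightarrow> fps_map f (fps_const c) = fps_const (f c)"
  by (rule fps_ext) (simp add: ring_mapD)

lemma ring_map_fps_to_fls: "ring_map (fps_to_fls :: complex fps \<Rightarrow> complex fls)"
  by (simp add: ring_map_def fls_times_fps_to_fls)

lemma ring_map_fps_const: "ring_map (fps_const :: 'a::comm_ring_1 \<Rightarrow> 'a fps)"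
  by (simp add: ring_map_def)

text \<open>Series in \<tau> have coefficients in a ring of power series, where a nonzero element
  need not be a unit. The hypothesis says that \<open>inverse\<close> is a genuine inverse on the
  constant term.\<close>

lemma fps_mult_inverse_eq_1:
  fixes F :: "'a::{comm_ring_1,inverse} fps"
  assumes "fps_nth F 0 * inverse (fps_nth F 0) = 1"
  shows "F * inverse F = 1"
  using fps_right_inverse[OF assms] by (simp add: fps_inverse_def)

lemma inverse_unique_comm_ring:
  fixes x y z :: "'a::comm_ring_1"
  assumes "x * y = 1" "x * z = 1"
  shows "y = z"
  by (metis assms mult.left_commute mult_1_right)

lemma fps_map_inverse:
  fixes F :: "'a::{comm_ring_1,inverse} fps" and f :: "'a \<Rightarrow> 'b::{comm_ring_1,inverse}"
  assumes f: "ring_map f" and "fps_nth F 0 * inverse (fps_nth F 0) = 1"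
    and "f (fps_nth F 0) * inverse (f (fps_nth F 0)) = 1"
  shows "fps_map f (inverse F) = inverse (fps_map f F)"
proof (rule inverse_unique_comm_ring)
  note h = ring_mapD[OF ring_map_fps_map[OF f]]
  show "fps_map f F * fps_map f (inverse F) = 1"
    by (simp only: fps_mult_inverse_eq_1[OF assms(2)] h flip: h(3))
  show "fps_map f F * inverse (fps_map f F) = 1"
    by (rule fps_mult_inverse_eq_1) (use assms in simp)
qed

text \<open>The logarithm is one fixed series with rational coefficients, so only compatibility with
  reciprocals of naturals has to be added to the ring axioms.\<close>

lemma fps_map_fps_log:
  fixes F :: "'a::{comm_ring_1,inverse} fps" and f :: "'a \<Rightarrow> 'b::{comm_ring_1,inverse}"
  assumes f: "ring_map f" and inv: "\<And>n. n \<noteq> 0 \<Longrightarrow> f (inverse (of_nat n)) = inverse (of_nat n)"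
  shows "fps_map f (fps_log F) = fps_log (fps_map f F)"
proof (rule fps_ext)
  fix n
  note h = ring_mapD[OF ring_map_fps_map[OF f]]
  have *: "f (fps_nth ((F - 1) ^ i) n) = fps_nth ((fps_map f F - 1) ^ i) n" for i
  proof -
    have "f (fps_nth ((F - 1) ^ i) n) = fps_nth (fps_map f ((F - 1) ^ i)) n" by simp
    also have "\<dots> = fps_nth ((fps_map f F - 1) ^ i) n" by (simp only: h)
    finally show ?thesis .
  qed
  show "fps_nth (fps_map f (fps_log F)) n = fps_nth (fps_log (fps_map f F)) n"
    by (auto simp: fps_log_def fps_compose_nth ring_mapD[OF f] inv * intro!: sum.cong)
qed

lemma fps_deriv_fps_log:
  fixes Y :: "'a::{idom,inverse} fps"
  assumes inv: "\<And>n. n \<noteq> 0 \<Longrightarrow> of_nat n * inverse (of_nat n) = (1 :: 'a)" and Y: "fps_nth Y 0 = 1"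
  shows "fps_deriv (fps_log Y) * Y = fps_deriv Y"
proof -
  define l :: "'a fps" where "l = Abs_fps (\<lambda>n. if n = 0 then 0 else (-1) ^ (n - 1) * inverse (of_nat n))"
  have "fps_deriv l = Abs_fps (\<lambda>n. (-1) ^ n)"
  proof (rule fps_ext)
    fix n
    show "fps_nth (fps_deriv l) n = fps_nth (Abs_fps (\<lambda>n. (-1) ^ n)) n"
      using inv[of "Suc n"] by (simp add: l_def mult.left_commute del: of_nat_Suc)
  qed
  then have "fps_nth (fps_deriv l * (1 + fps_X)) n = fps_nth 1 n" for n
    by (cases n) (simp_all add: distrib_left)
  then have "fps_deriv l * (1 + fps_X) = 1" by (rule fps_ext)
  then have "(fps_deriv l * (1 + fps_X)) oo (Y - 1) = 1" by simp
  then have "(fps_deriv l oo (Y - 1)) * Y = 1"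
    using Y by (simp add: fps_compose_mult_distrib fps_compose_add_distrib)
  moreover have "fps_deriv (fps_log Y) = (fps_deriv l oo (Y - 1)) * fps_deriv Y"
    unfolding fps_log_def l_def[symmetric] using Y by (subst fps_compose_deriv) auto
  ultimately show ?thesis by (metis mult.commute mult.left_commute mult_1_right)
qed

section \<open>Derivatives and residues in \<open>w\<close>, taken coefficientwise in
  \<hbar>\<close>

lemma fps_map_add:
  "(\<And>x y. f (x + y) = f x + f y) \<Longrightarrow> fps_map f (A + B) = fps_map f A + fps_map f B"
  by (rule fps_ext) simp

lemma fps_map_fls_deriv_mult:
  fixes A B :: "'a::comm_ring_1 fls fps"
  shows "fps_map fls_deriv (A * B) = A * fps_map fls_deriv B + fps_map fls_deriv A * B"
  by (rule fps_ext) (simp add: fps_mult_nth fls_deriv_sum sum.distrib)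

lemma fps_map_fls_deriv_fps_deriv:
  fixes A :: "'a::comm_ring_1 fls fps"
  shows "fps_map fls_deriv (fps_deriv A) = fps_deriv (fps_map fls_deriv A)"
  by (rule fps_ext) (simp flip: of_nat_Suc)

lemma res_w_add: "res_w (A + B) = res_w A + res_w B"
  unfolding res_w_def by (rule fps_map_add) simp

lemma res_w_const_mult: "res_w (fps_map fls_const c * A) = c * res_w A"
  by (rule fps_ext) (simp add: res_w_def fps_mult_nth fls_nth_sum)

lemma res_w_fps_map_fps_to_fls: "res_w (fps_map fps_to_fls A) = 0"
  by (rule fps_ext) (simp add: res_w_def)

lemma fps_deriv_res_w: "fps_deriv (res_w A) = res_w (fps_deriv A)"
  by (rule fps_ext) (simp add: res_w_def fls_of_nat flip: of_nat_Suc)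

lemma res_w_fls_deriv: "res_w (fps_map fls_deriv A) = 0"
  by (rule fps_ext) (simp add: res_w_def)

text \<open>For \<open>W\<close> with a simple zero at \<open>w = 0\<close> when \<open>\<hbar> = 0\<close>, \<open>g \<mapsto> res g d log W\<close> kills the ideal
  generated by \<open>W\<close>, so it is evaluation at the root of \<open>W\<close>.\<close>

definition root_eval :: "complex fps fps \<Rightarrow> complex fps fps \<Rightarrow> complex fps" where
  "root_eval W g = res_w (fps_map fps_to_fls g * dlog (fps_map fps_to_fls W))"

context
  fixes W :: "complex fps fps"
  assumes W0: "fps_nth (fps_nth W 0) 0 = 0" and W1: "fps_nth (fps_nth W 0) 1 \<noteq> 0"
begin

lemma subdegree_W0: "subdegree (fps_nth W 0) = 1"
  by (rule subdegreeI) (use W0 W1 in auto)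

lemma W_mult_inverse:
  "fps_map fps_to_fls W * inverse (fps_map fps_to_fls W) = 1"
  using W1 by (intro inverse_mult_eq_1') auto

lemma root_eval_add: "root_eval W (g + h) = root_eval W g + root_eval W h"
  by (simp add: root_eval_def ring_mapD[OF ring_map_fps_map[OF ring_map_fps_to_fls]] distrib_right res_w_add)

text \<open>In \<open>complex fps fps\<close> the outer variable is \<hbar> and the inner one is
  \<open>w\<close>. Hence \<open>fps_map fps_const c\<close> is a series in \<hbar> independent of
  \<open>w\<close>, \<open>fps_X\<close> is \<hbar> and \<open>fps_const fps_X\<close> is
  \<open>w\<close>.\<close>

lemma root_eval_const_mult: "root_eval W (fps_map fps_const c * g) = c * root_eval W g"
  by (simp add: root_eval_def ring_mapD[OF ring_map_fps_map[OF ring_map_fps_to_fls]] mult.assoc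
      fps_map_compose res_w_const_mult)

text \<open>The factor \<open>W\<close> cancels the denominator of \<open>dlog\<close>; what remains
  is regular at \<open>w = 0\<close>.\<close>

lemma root_eval_W_mult: "root_eval W (W * h) = 0"
proof -
  let ?i = "fps_map fps_to_fls"
  have "?i (W * h) * dlog (?i W) = ?i h * fps_map fls_deriv (?i W) * (?i W * inverse (?i W))"
    by (simp add: dlog_def ring_mapD[OF ring_map_fps_map[OF ring_map_fps_to_fls]] mult_ac)
  also have "\<dots> = ?i (h * fps_map fps_deriv W)"
    unfolding W_mult_inverse
    by (simp add: ring_mapD[OF ring_map_fps_map[OF ring_map_fps_to_fls]] fps_map_compose fls_deriv_fps_to_fls)
  finally show ?thesis by (simp only: root_eval_def res_w_fps_map_fps_to_fls)
qed

text \<open>The \<open>\<hbar>\<close>-derivative of \<open>(\<partial>\<^sub>w W / W) dw\<close> is the exact form \<open>\<partial>\<^sub>w (\<partial>\<^sub>\<hbar> W / W) dw\<close>, so the residue does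
  not depend on \<open>\<hbar>\<close>.\<close>

lemma root_eval_1: "root_eval W 1 = 1"
proof -
  define V where "V = fps_map fps_to_fls W"
  let ?D = "fps_map fls_deriv"
  have V: "V * inverse V = 1" "fps_nth V 0 \<noteq> 0"
    using W_mult_inverse W1 by (auto simp: V_def)
  \<comment> \<open>\<open>?D\<close> differentiates in \<open>w\<close> and not in \<hbar>, so its
    value on \<open>inverse V\<close> is read off from the product rule.\<close>
  have "?D (V * inverse V) = 0" unfolding V by (rule fps_ext) simp
  then have "V * ?D (inverse V) = - (?D V * inverse V)"
    by (simp add: fps_map_fls_deriv_mult eq_neg_iff_add_eq_0)
  then have "inverse V * (V * ?D (inverse V)) = inverse V * - (?D V * inverse V)" by (rule arg_cong)
  moreover have "inverse V * (V * ?D (inverse V)) = ?D (inverse V)"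
    using V by (metis mult.assoc mult.commute mult_1_left)
  ultimately have DI: "?D (inverse V) = - (?D V * (inverse V)\<^sup>2)" by (simp add: power2_eq_square mult_ac)
  have "fps_deriv (dlog V) = fps_deriv (?D V) * inverse V - ?D V * fps_deriv V * (inverse V)\<^sup>2"
    unfolding dlog_def by (simp add: fps_inverse_deriv[OF V(2)] algebra_simps)
  also have "\<dots> = ?D (fps_deriv V * inverse V)"
    by (simp add: fps_map_fls_deriv_mult fps_map_fls_deriv_fps_deriv DI algebra_simps)
  finally have "fps_deriv (res_w (dlog V)) = 0" by (simp add: fps_deriv_res_w res_w_fls_deriv)
  then have "res_w (dlog V) = fps_const (fps_nth (res_w (dlog V)) 0)" by (simp add: fps_deriv_eq_0_iff)
  \<comment> \<open>At \<hbar> = 0 the residue of a logarithmic derivative is the order of the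
    zero.\<close>
  also have "fps_nth (res_w (dlog V)) 0 = of_int (fls_subdegree (fps_to_fls (fps_nth W 0)))"
    using fls_residue_deriv_times_inverse_eq_subdegree(1)[of "fps_to_fls (fps_nth W 0)"]
    by (simp add: res_w_def dlog_def V_def)
  also have "\<dots> = 1" by (simp add: fls_subdegree_fls_to_fps subdegree_W0)
  finally have "res_w (dlog V) = 1" by simp
  moreover have "fps_map fps_to_fls (1 :: complex fps fps) = 1"
    by (rule ring_mapD[OF ring_map_fps_map[OF ring_map_fps_to_fls]])
  ultimately show ?thesis by (simp add: root_eval_def V_def)
qed

lemma root_eval_const: "root_eval W (fps_map fps_const c) = c"
  using root_eval_const_mult[of c 1] by (simp add: root_eval_1)

lemma W0_division: "\<exists>k. e = fps_const (fps_nth e 0) + fps_nth W 0 * k"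
proof -
  define V where "V = fps_shift 1 (fps_nth W 0)"
  have "fps_nth W 0 = fps_X * V" using W0 by (simp add: V_def fps_eq_iff)
  moreover have "V * inverse V = 1" using W1 by (intro inverse_mult_eq_1') (simp add: V_def)
  moreover have "e = fps_const (fps_nth e 0) + fps_X * fps_shift 1 e" by (simp add: fps_eq_iff)
  ultimately show ?thesis
    by (intro exI[of _ "inverse V * fps_shift 1 e"]) (metis mult.assoc mult_1_right)
qed

text \<open>Weierstrass division by \<open>W\<close> up to order \<open>N\<close> in \<hbar>: the
  zero at \<hbar> = 0 is simple, so the remainder does not depend on \<open>w\<close>. Each step
  divides the leading \<hbar>-coefficient of the error by \<open>fps_nth W 0\<close>, leaving an
  error divisible by \<hbar>.\<close>

lemma weierstrass_division:
  "\<exists>c h e. g = fps_map fps_const c + W * h + fps_X ^ N * e"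
proof (induction N)
  case 0
  show ?case by (intro exI[of _ 0] exI[of _ g]) (simp add: ring_mapD[OF ring_map_fps_map[OF ring_map_fps_const]])
next
  case (Suc N)
  then obtain c h e where g: "g = fps_map fps_const c + W * h + fps_X ^ N * e" by blast
  obtain k where k: "fps_nth e 0 = fps_const (fps_nth (fps_nth e 0) 0) + fps_nth W 0 * k"
    using W0_division by blast
  define c' where "c' = fps_const (fps_nth (fps_nth e 0) 0)"
  define e' where "e' = e - fps_map fps_const c' - W * fps_const k"
  have "fps_nth e 0 - c' = fps_nth W 0 * k" using k unfolding c'_def by (metis add_diff_cancel_left')
  moreover have "fps_const (fps_nth c' 0) = c'" by (simp add: c'_def)
  ultimately have "fps_nth e' 0 = 0" by (simp add: e'_def)
  then have "e' = fps_X * fps_shift 1 e'" by (simp add: fps_eq_iff)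
  then have e: "e = fps_map fps_const c' + W * fps_const k + fps_X * fps_shift 1 e'"
    by (simp add: e'_def algebra_simps)
  have X: "fps_map fps_const fps_X = fps_X" by (simp add: fps_eq_iff fps_X_def)
  have "g = fps_map fps_const (c + fps_X ^ N * c') + W * (h + fps_X ^ N * fps_const k)
      + fps_X ^ Suc N * fps_shift 1 e'"
    unfolding g by (subst e) (simp add: ring_mapD[OF ring_map_fps_map[OF ring_map_fps_const]] algebra_simps X)
  then show ?case by blast
qed

lemma root_eval_X_power: "root_eval W (fps_X ^ N * g) = fps_X ^ N * root_eval W g"
proof -
  have "fps_X ^ N = fps_map fps_const (fps_X ^ N)" by (simp add: fps_eq_iff fps_X_power_nth)
  then show ?thesis using root_eval_const_mult by metis
qed

lemma root_eval_nth_0: "fps_nth (root_eval W g) 0 = fps_nth (fps_nth g 0) 0"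
proof -
  obtain c h e where g: "g = fps_map fps_const c + W * h + fps_X ^ 1 * e"
    using weierstrass_division by blast
  have "root_eval W g = c + fps_X ^ 1 * root_eval W e"
    unfolding g by (simp only: root_eval_add root_eval_const root_eval_W_mult root_eval_X_power add_0_right)
  then show ?thesis using W0 by (simp add: g)
qed

text \<open>Modulo any power of \<hbar>, \<open>g\<close> is independent of \<open>w\<close> up to a
  multiple of \<open>W\<close>. Evaluation is linear over such constants and kills multiples of
  \<open>W\<close>, so the defect \<open>D\<close> is divisible by every power of \<hbar>.\<close>

lemma root_eval_mult: "root_eval W (g * g') = root_eval W g * root_eval W g'"
proof -
  define D where "D = root_eval W (g * g') - root_eval W g * root_eval W g'"
  have "fps_nth D n = 0" for n
  proof -
    obtain c h e where g: "g = fps_map fps_const c + W * h + fps_X ^ Suc n * e"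
      using weierstrass_division by blast
    have 1: "root_eval W g = c + fps_X ^ Suc n * root_eval W e"
      unfolding g by (simp only: root_eval_add root_eval_const root_eval_W_mult root_eval_X_power add_0_right)
    have "g * g' = fps_map fps_const c * g' + W * (h * g') + fps_X ^ Suc n * (e * g')"
      unfolding g by (simp only: distrib_right mult.assoc)
    then have "root_eval W (g * g') = c * root_eval W g' + fps_X ^ Suc n * root_eval W (e * g')"
      by (simp only: root_eval_add root_eval_const_mult root_eval_W_mult root_eval_X_power add_0_right)
    then have "D = fps_X ^ Suc n * (root_eval W (e * g') - root_eval W e * root_eval W g')"
      by (simp only: D_def 1) (simp add: algebra_simps)
    then show ?thesis by (simp only: fps_X_power_mult_nth) simp
  qed
  then have "D = 0" by (simp add: fps_eq_iff)
  then show ?thesis by (simp add: D_def)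
qed

lemma ring_map_root_eval: "ring_map (root_eval W)"
  by (simp add: ring_map_def root_eval_1 root_eval_add root_eval_mult)

end

section \<open>Taylor expansion in \<open>u\<close>\<close>

lemma fps_mult_nth_eq_0:
  assumes "\<And>n. n < M \<Longrightarrow> fps_nth B n = 0" "n < M"
  shows "fps_nth (A * B) n = (0 :: 'a::comm_ring_1)"
  using assms by (auto simp: fps_mult_nth intro!: sum.neutral)

text \<open>Since \<open>1 + r - r w\<close> is a unit at \<open>w = 0\<close>, the series
  \<open>u\<close>, \<open>W\<close> and their \<open>\<partial>\<^sub>u\<close>-derivatives are
  regular there. These versions over \<open>complex fps\<close> are the ones
  \<open>root_eval\<close> accepts.\<close>

definition log_fps :: "complex fps" where
  "log_fps = fps_ln 1 oo (- fps_X)"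

definition du_fps :: "nat \<Rightarrow> complex fps \<Rightarrow> complex fps" where
  "du_fps r F = (fps_X - 1) * inverse (1 + of_nat r - of_nat r * fps_X) * fps_deriv F"

abbreviation du_fps_h :: "nat \<Rightarrow> complex fps fps \<Rightarrow> complex fps fps" where
  "du_fps_h r \<equiv> fps_map (du_fps r)"

definition u_fps :: "nat \<Rightarrow> complex fps" where
  "u_fps r = log_fps - of_nat r * fps_X"

definition W_fps :: "nat \<Rightarrow> complex fps fps" where
  "W_fps r = Abs_fps (\<lambda>n. fps_const (fps_nth (inverse S_fps) n * of_nat r ^ n) * (du_fps r ^^ n) log_fps)"

lemma one_plus_of_nat_nonzero: "1 + of_nat r \<noteq> (0::complex)"
  by (metis of_nat_Suc of_nat_eq_0_iff nat.distinct(1))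

lemma du_denominator_nth_0 [simp]: "fps_nth (1 + of_nat r - of_nat r * fps_X :: complex fps) 0 \<noteq> 0"
  using one_plus_of_nat_nonzero by simp

lemma d_du_fps_to_fls: "d_du r (fps_to_fls F) = fps_to_fls (du_fps r F)"
proof -
  let ?E = "1 + of_nat r - of_nat r * fps_X :: complex fps"
  have "inverse (fps_to_fls ?E) = fps_to_fls (inverse ?E)"
    by (rule fls_inverse_fps_to_fls) (simp add: subdegree_eq_0_iff one_plus_of_nat_nonzero)
  then show ?thesis
    by (simp add: d_du_def du_fps_def fls_times_fps_to_fls fls_deriv_fps_to_fls divide_inverse)
qed

lemma d_du_funpow_fps_to_fls: "(d_du r ^^ n) (fps_to_fls F) = fps_to_fls ((du_fps r ^^ n) F)"
  by (induction n) (auto simp: d_du_fps_to_fls)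

lemma W_ser_eq: "W_ser r = fps_map fps_to_fls (W_fps r)"
  by (rule fps_ext)
     (simp add: W_ser_def W_fps_def log_1_minus_w_def d_du_funpow_fps_to_fls fls_times_fps_to_fls flip: log_fps_def)

lemma u_w_eq: "u_w r = fps_to_fls (u_fps r)"
  by (simp add: u_w_def u_fps_def log_1_minus_w_def fls_times_fps_to_fls flip: log_fps_def)

lemma d_du_h_fps_to_fls: "d_du_h r (fps_map fps_to_fls F) = fps_map fps_to_fls (du_fps_h r F)"
  by (rule fps_ext) (simp add: d_du_fps_to_fls)

lemma d_du_h_funpow_fps_to_fls:
  "(d_du_h r ^^ n) (fps_map fps_to_fls F) = fps_map fps_to_fls ((du_fps_h r ^^ n) F)"
  by (induction n) (auto simp: d_du_h_fps_to_fls)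

lemma du_fps_h_funpow_nth: "fps_nth ((du_fps_h r ^^ m) F) n = (du_fps r ^^ m) (fps_nth F n)"
  by (induction m arbitrary: n) auto

lemma du_fps_diff: "du_fps r (F - G) = du_fps r F - du_fps r G"
  by (simp add: du_fps_def algebra_simps)

lemma du_fps_sum: "du_fps r (sum F A) = (\<Sum>a\<in>A. du_fps r (F a))"
  by (simp add: du_fps_def fps_deriv_sum sum_distrib_left)

lemma du_fps_const_mult: "du_fps r (fps_const c * F) = fps_const c * du_fps r F"
  by (simp add: du_fps_def algebra_simps)

lemma du_fps_funpow_const_mult: "(du_fps r ^^ n) (fps_const c * F) = fps_const c * (du_fps r ^^ n) F"
  by (induction n) (auto simp: du_fps_const_mult)

lemma du_fps_power: "du_fps r (F ^ Suc m) = of_nat (Suc m) * F ^ m * du_fps r F"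
  by (simp add: du_fps_def fps_deriv_power fps_of_nat algebra_simps del: power_Suc of_nat_Suc)

lemma fps_deriv_log_fps: "fps_deriv log_fps = - inverse (1 - fps_X)"
proof -
  have "fps_deriv log_fps = (inverse (1 + fps_X) oo - fps_X) * (- 1)"
    unfolding log_fps_def by (subst fps_compose_deriv) (auto simp: fps_ln_deriv)
  also have "inverse (1 + fps_X) oo - fps_X = inverse ((1 + fps_X) oo - fps_X :: complex fps)"
    by (rule fps_inverse_compose) auto
  finally show ?thesis by (simp add: fps_compose_add_distrib)
qed

lemma inverse_one_minus_fps_X: "(1 - fps_X) * inverse (1 - fps_X) = (1 :: complex fps)"
  by (rule inverse_mult_eq_1') simp

lemma du_log_fps: "du_fps r log_fps = inverse (1 + of_nat r - of_nat r * fps_X)"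
proof -
  have "du_fps r log_fps = inverse (1 + of_nat r - of_nat r * fps_X) * ((1 - fps_X) * inverse (1 - fps_X))"
    by (simp add: du_fps_def fps_deriv_log_fps algebra_simps)
  then show ?thesis by (simp only: inverse_one_minus_fps_X mult_1_right)
qed

lemma du_u_fps: "du_fps r (u_fps r) = 1"
proof -
  let ?E = "1 + of_nat r - of_nat r * fps_X :: complex fps"
  have "du_fps r (of_nat r * fps_X) = (fps_X - 1) * inverse ?E * of_nat r"
    by (simp add: du_fps_def)
  then have "du_fps r (u_fps r) = ?E * inverse ?E"
    by (simp add: u_fps_def du_fps_diff du_log_fps algebra_simps)
  also have "\<dots> = 1" by (rule inverse_mult_eq_1'[OF du_denominator_nth_0])
  finally show ?thesis .
qed

lemma u_fps_nth_0 [simp]: "fps_nth (u_fps r) 0 = 0"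
  by (simp add: u_fps_def log_fps_def)

text \<open>By \<open>\<partial>\<^sub>u u = 1\<close>, applying \<open>\<partial>\<^sub>u\<close>
  to the remainder of order \<open>M + 1\<close> of \<open>F\<close> gives the remainder of order
  \<open>M\<close> of \<open>\<partial>\<^sub>u F\<close>. This raises the order of vanishing by
  one, once the constant term is known to vanish.\<close>

lemma taylor_remainder_nth:
  assumes "n < M"
  shows "fps_nth (F - (\<Sum>m<M. fps_const (fps_nth ((du_fps r ^^ m) F) 0 / fact m) * u_fps r ^ m)) n = 0"
  using assms
proof (induction M arbitrary: F n)
  case (Suc M)
  let ?T = "\<lambda>M F. \<Sum>m<M. fps_const (fps_nth ((du_fps r ^^ m) F) 0 / fact m) * u_fps r ^ m"
  \<comment> \<open>\<open>\<partial>\<^sub>u\<close> is \<open>E\<close> times the ordinary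
    derivative, and \<open>E\<close> is a unit at \<open>w = 0\<close>, so orders of vanishing
    transfer.\<close>
  define E where "E = (fps_X - 1) * inverse (1 + of_nat r - of_nat r * fps_X :: complex fps)"
  have "fps_nth E 0 \<noteq> 0" using one_plus_of_nat_nonzero by (simp add: E_def)
  then have "inverse E * E = 1" by (rule inverse_mult_eq_1)
  then have D: "fps_deriv R = inverse E * du_fps r R" for R
    by (simp add: du_fps_def flip: E_def mult.assoc)
  have step: "du_fps r (fps_const (c / fact (Suc m)) * u_fps r ^ Suc m) = fps_const (c / fact m) * u_fps r ^ m" for c m
  proof -
    have "du_fps r (fps_const (c / fact (Suc m)) * u_fps r ^ Suc m)
        = fps_const (c / fact (Suc m)) * of_nat (Suc m) * u_fps r ^ m"
      by (simp only: du_fps_const_mult du_fps_power du_u_fps mult.assoc mult_1_right)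
    also have "fps_const (c / fact (Suc m)) * of_nat (Suc m) = fps_const (c / fact m)"
      by (simp flip: fps_of_nat del: of_nat_Suc)
    finally show ?thesis .
  qed
  have "?T (Suc M) F = fps_const (fps_nth F 0)
      + (\<Sum>m<M. fps_const (fps_nth ((du_fps r ^^ m) (du_fps r F)) 0 / fact (Suc m)) * u_fps r ^ Suc m)"
    unfolding sum.lessThan_Suc_shift by (simp add: funpow_Suc_right del: funpow.simps(2) power_Suc fact_Suc)
  moreover have "du_fps r (fps_const c + G) = du_fps r G" for c G by (simp add: du_fps_def)
  ultimately have "du_fps r (?T (Suc M) F) = ?T M (du_fps r F)"
    by (simp only: du_fps_sum step)
  then have dR: "du_fps r (F - ?T (Suc M) F) = du_fps r F - ?T M (du_fps r F)"
    by (simp only: du_fps_diff)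
  show ?case
  proof (cases n)
    case 0
    then show ?thesis by (simp add: sum.lessThan_Suc_shift fps_sum_nth del: sum.lessThan_Suc)
  next
    case (Suc k)
    have "fps_nth (fps_deriv (F - ?T (Suc M) F)) k = 0"
      unfolding D dR
    proof (rule fps_mult_nth_eq_0)
      show "fps_nth (du_fps r F - ?T M (du_fps r F)) j = 0" if "j < M" for j
        using that by (rule Suc.IH)
      show "k < M" using Suc Suc.prems by simp
    qed
    then have "of_nat (Suc k) * fps_nth (F - ?T (Suc M) F) (Suc k) = 0"
      by (simp only: fps_deriv_nth Suc_eq_plus1)
    then show ?thesis using Suc by (simp only: mult_eq_0_iff of_nat_eq_0_iff) simp
  qed
qed simp

definition at_0 :: "complex fps fps \<Rightarrow> complex fps" where
  "at_0 = fps_map (\<lambda>F. fps_nth F 0)"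

lemma fps_sums_iff:
  fixes f :: "nat \<Rightarrow> 'a::ab_group_add fps"
  shows "f sums s \<longleftrightarrow> (\<forall>n. \<forall>\<^sub>F M in sequentially. (\<Sum>m<M. fps_nth (f m) n) = fps_nth s n)"
  by (simp add: sums_def tendsto_fps_iff fps_sum_nth)

lemma fps_sums_diff:
  fixes f g :: "nat \<Rightarrow> 'a::ab_group_add fps"
  assumes "f sums s" "g sums t"
  shows "(\<lambda>m. f m - g m) sums (s - t)"
  unfolding fps_sums_iff
proof
  fix n
  from assms have "\<forall>\<^sub>F M in sequentially. (\<Sum>m<M. fps_nth (f m) n) = fps_nth s n"
    "\<forall>\<^sub>F M in sequentially. (\<Sum>m<M. fps_nth (g m) n) = fps_nth t n"
    by (auto simp: fps_sums_iff)
  then show "\<forall>\<^sub>F M in sequentially. (\<Sum>m<M. fps_nth (f m - g m) n) = fps_nth (s - t) n"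
    by eventually_elim (simp add: sum_subtractf)
qed

text \<open>Evaluation is applied to a Taylor polynomial in \<open>u\<close> with remainder
  \<open>w ^ M * h\<close>. The root is 0 at \<hbar> = 0, so the evaluated remainder is divisible by
  the \<open>M\<close>-th power of \<hbar>.\<close>

lemma root_eval_taylor:
  assumes W: "fps_nth (fps_nth W 0) 0 = 0" "fps_nth (fps_nth W 0) 1 \<noteq> 0"
  shows "(\<lambda>m. at_0 ((du_fps_h r ^^ m) g) * root_eval W (fps_const (u_fps r)) ^ m * fps_const (1 / fact m))
    sums root_eval W g"
proof -
  let ?U = "root_eval W (fps_const (u_fps r))" and ?v = "\<lambda>m. at_0 ((du_fps_h r ^^ m) g)"
  let ?t = "\<lambda>m. ?v m * ?U ^ m * fps_const (1 / fact m)"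
  note ev = ring_mapD[OF ring_map_root_eval[OF W]]
  have *: "fps_nth (root_eval W g) n = (\<Sum>m<M. fps_nth (?t m) n)" if "n < M" for n M
  proof -
    define R where "R = (\<lambda>k. fps_nth g k - (\<Sum>m<M. fps_const (fps_nth ((du_fps r ^^ m) (fps_nth g k)) 0 / fact m) * u_fps r ^ m))"
    define h where "h = Abs_fps (\<lambda>k. fps_shift M (R k))"
    have R: "R k = fps_X ^ M * fps_shift M (R k)" for k
      unfolding R_def by (rule fps_ext) (use taylor_remainder_nth in \<open>auto simp: fps_X_power_mult_nth\<close>)
    have "g = (\<Sum>m<M. fps_map fps_const (?v m * fps_const (1 / fact m)) * fps_const (u_fps r) ^ m) + fps_const fps_X ^ M * h"
    proof (rule fps_ext)
      fix k
      have "fps_nth g k = (\<Sum>m<M. fps_const (fps_nth ((du_fps r ^^ m) (fps_nth g k)) 0 / fact m) * u_fps r ^ m) + R k"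
        by (simp add: R_def)
      then show "fps_nth g k = fps_nth ((\<Sum>m<M. fps_map fps_const (?v m * fps_const (1 / fact m)) * fps_const (u_fps r) ^ m)
          + fps_const fps_X ^ M * h) k"
        by (subst (asm) R) (simp add: fps_sum_nth at_0_def du_fps_h_funpow_nth h_def)
    qed
    then have "root_eval W g = root_eval W ((\<Sum>m<M. fps_map fps_const (?v m * fps_const (1 / fact m)) * fps_const (u_fps r) ^ m)
        + fps_const fps_X ^ M * h)" by (rule arg_cong)
    also have "\<dots> = (\<Sum>m<M. ?v m * fps_const (1 / fact m) * ?U ^ m) + root_eval W (fps_const fps_X) ^ M * root_eval W h"
      by (simp only: ev root_eval_const_mult[OF W] root_eval_const[OF W])
    finally have "fps_nth (root_eval W g) n = (\<Sum>m<M. fps_nth (?v m * fps_const (1 / fact m) * ?U ^ m) n)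
        + fps_nth (root_eval W h * root_eval W (fps_const fps_X) ^ M) n"
      by (simp add: fps_sum_nth mult.commute)
    also have "fps_nth (root_eval W h * root_eval W (fps_const fps_X) ^ M) n = 0"
      by (rule fps_mult_nth_eq_0[OF _ that])
         (use startsby_zero_power_prefix[of "root_eval W (fps_const fps_X)" M] root_eval_nth_0[OF W, of "fps_const fps_X"] in auto)
    finally show ?thesis by (simp add: mult_ac)
  qed
  show ?thesis unfolding fps_sums_iff
  proof
    fix n
    show "\<forall>\<^sub>F M in sequentially. (\<Sum>m<M. fps_nth (?t m) n) = fps_nth (root_eval W g) n"
      using eventually_gt_at_top[of n] by eventually_elim (simp add: *)
  qed
qed

section \<open>The starred series\<close>

text \<open>Evenness enters twice: it is part of the characterisation of \<open>ustar\<close>, and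
  evenness of 1/S settles the sign in \<open>f_ser_eq\<close>.\<close>

definition even_fps :: "'a::zero fps \<Rightarrow> bool" where
  "even_fps F \<longleftrightarrow> (\<forall>n. odd n \<longrightarrow> fps_nth F n = 0)"

lemma even_fps_mult:
  fixes F G :: "'a::comm_ring_1 fps"
  assumes "even_fps F" "even_fps G"
  shows "even_fps (F * G)"
  unfolding even_fps_def fps_mult_nth
proof (intro allI impI sum.neutral ballI)
  fix n i :: nat
  assume "odd n" "i \<in> {0..n}"
  then consider "odd i" | "odd (n - i)" by auto
  then show "fps_nth F i * fps_nth G (n - i) = 0"
    using assms unfolding even_fps_def by cases (metis mult_zero_left, metis mult_zero_right)
qed

lemma even_fps_const: "even_fps (fps_const c)"
  by (auto simp: even_fps_def)

lemma even_fps_map: "even_fps F \<Longrightarrow> f 0 = 0 \<Longrightarrow> even_fps (fps_map f F)"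
  by (auto simp: even_fps_def)

lemma even_fps_inverse:
  fixes F :: "'a::field fps"
  assumes F: "even_fps F" and F0: "fps_nth F 0 \<noteq> 0"
  shows "even_fps (inverse F)"
  unfolding even_fps_def
proof (intro allI impI)
  fix n :: nat
  assume "odd n"
  then show "fps_nth (inverse F) n = 0"
  proof (induction n rule: less_induct)
    case (less n)
    have "0 = fps_nth (F * inverse F) n" using less.prems inverse_mult_eq_1'[OF F0] by (cases n) auto
    also have "\<dots> = fps_nth F 0 * fps_nth (inverse F) n + (\<Sum>i\<in>{0<..n}. fps_nth F i * fps_nth (inverse F) (n - i))"
      by (simp add: fps_mult_nth sum.head)
    also have "(\<Sum>i\<in>{0<..n}. fps_nth F i * fps_nth (inverse F) (n - i)) = 0"
    proof (rule sum.neutral, rule ballI)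
      fix i assume i: "i \<in> {0<..n}"
      show "fps_nth F i * fps_nth (inverse F) (n - i) = 0"
      proof (cases "odd i")
        case False
        then have "odd (n - i)" "n - i < n" using less.prems i by auto
        then show ?thesis using less.IH by simp
      qed (use F in \<open>auto simp: even_fps_def\<close>)
    qed
    finally show ?case using F0 by simp
  qed
qed

text \<open>The constant terms of the exponentials cancel, so division by \<open>fps_X\<close> is an
  exact shift. For odd \<open>n\<close> the powers have even exponent and cancel, hence S is
  even.\<close>

lemma S_fps_nth: "fps_nth S_fps n = ((1/2) ^ Suc n - (- (1/2)) ^ Suc n) / fact (Suc n)"
proof -
  have "fps_exp (1/2) - fps_exp (-(1/2)) = fps_X * fps_shift 1 (fps_exp (1/2) - fps_exp (-(1/2)) :: complex fps)"
    by (simp add: fps_eq_iff)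
  then have "S_fps = fps_shift 1 (fps_exp (1/2) - fps_exp (-(1/2)))"
    unfolding S_fps_def by (metis fps_X_neq_zero nonzero_mult_div_cancel_left)
  then have "fps_nth S_fps n = fps_nth (fps_exp (1/2)) (Suc n) - fps_nth (fps_exp (-(1/2))) (Suc n)"
    by (metis Suc_eq_plus1 fps_shift_nth fps_sub_nth)
  then show ?thesis by (simp only: fps_exp_def fps_nth_Abs_fps of_nat_fact diff_divide_distrib)
qed

lemma S_fps_nth_0: "fps_nth S_fps 0 = 1"
  by (simp add: S_fps_nth)

lemma even_fps_inverse_S_fps: "even_fps (inverse S_fps)"
  by (rule even_fps_inverse) (auto simp: even_fps_def S_fps_nth)

text \<open>Under \<open>Z = w - 1\<close> the operator \<open>Z / (1 - r Z) d/dZ\<close> becomes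
  \<open>\<partial>\<^sub>u\<close>, and \<open>\<partial>\<^sub>u log (1 - w)\<close> is \<xi> of
  index 0, whence the shift from \<open>m\<close> to \<open>Suc m\<close>.\<close>

lemma has_fps_expansion_xi_rat:
  "(\<lambda>w. xi_rat r m (w - 1)) has_fps_expansion (du_fps r ^^ Suc m) log_fps"
proof (induction m)
  case 0
  have "(\<lambda>w::complex. inverse (1 + of_nat r - of_nat r * w)) has_fps_expansion
      inverse (fps_const (1 + of_nat r) - fps_const (of_nat r) * fps_X)"
    by (intro fps_expansion_intros) (use one_plus_of_nat_nonzero in auto)
  moreover have "fps_const (1 + of_nat r) - fps_const (of_nat r) * fps_X = (1 + of_nat r - of_nat r * fps_X :: complex fps)"
    by (simp add: fps_of_nat flip: fps_const_add)
  moreover have "xi_rat r 0 (w - 1) = inverse (1 + of_nat r - of_nat r * w)" for w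
    by (simp add: xi_rat_def inverse_eq_divide algebra_simps)
  ultimately show ?case by (simp only: funpow.simps o_apply id_apply du_log_fps)
next
  case (Suc m)
  let ?F = "(du_fps r ^^ Suc m) log_fps"
  have "(\<lambda>w. (w - 1) * inverse (1 + of_nat r - of_nat r * w) * deriv (\<lambda>w. xi_rat r m (w - 1)) w) has_fps_expansion
      (fps_X - 1) * inverse (fps_const (1 + of_nat r) - fps_const (of_nat r) * fps_X) * fps_deriv ?F"
    by (intro fps_expansion_intros Suc.IH) (use one_plus_of_nat_nonzero in auto)
  also have "fps_const (1 + of_nat r) - fps_const (of_nat r) * fps_X = (1 + of_nat r - of_nat r * fps_X :: complex fps)"
    by (simp add: fps_of_nat flip: fps_const_add)
  also have "(fps_X - 1) * inverse (1 + of_nat r - of_nat r * fps_X) * fps_deriv ?F = (du_fps r ^^ Suc (Suc m)) log_fps"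
    by (simp add: du_fps_def)
  finally have *: "(\<lambda>w. (w - 1) * inverse (1 + of_nat r - of_nat r * w) * deriv (\<lambda>w. xi_rat r m (w - 1)) w)
      has_fps_expansion (du_fps r ^^ Suc (Suc m)) log_fps" .
  have "open (- ((\<lambda>w. (w - 1) * (1 + of_nat r - of_nat r * w)) -` {0::complex}))"
    by (intro open_Compl continuous_closed_vimage continuous_intros)
  then have "eventually (\<lambda>w::complex. w \<in> - ((\<lambda>w. (w - 1) * (1 + of_nat r - of_nat r * w)) -` {0})) (nhds 0)"
  proof (rule eventually_nhds_in_open)
    have "- 1 \<noteq> complex_of_nat r" using one_plus_of_nat_nonzero[of r] by (metis add.right_inverse)
    then show "0 \<in> - ((\<lambda>w::complex. (w - 1) * (1 + of_nat r - of_nat r * w)) -` {0})" by auto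
  qed
  then have "eventually (\<lambda>w. (w - 1) * inverse (1 + of_nat r - of_nat r * w) * deriv (\<lambda>w. xi_rat r m (w - 1)) w
      = xi_rat r (Suc m) (w - 1)) (nhds 0)"
  proof eventually_elim
    case (elim w)
    then have w: "w - 1 \<noteq> 0" "1 + of_nat r - of_nat r * w \<noteq> 0" by auto
    then have "of_nat r * (w - 1) \<noteq> 1" by (auto simp: algebra_simps)
    from xi_rat_has_derivative[OF this w(1), of m]
    have "((\<lambda>w. xi_rat r m (w - 1)) has_field_derivative
        (1 - of_nat r * (w - 1)) * xi_rat r (Suc m) (w - 1) / (w - 1) * 1) (at w)"
      by (rule DERIV_chain2) (auto intro!: derivative_eq_intros)
    then have d: "deriv (\<lambda>w. xi_rat r m (w - 1)) w = (1 - of_nat r * (w - 1)) * xi_rat r (Suc m) (w - 1) / (w - 1)"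
      by (simp add: DERIV_imp_deriv)
    have *: "1 - of_nat r * (w - 1) = 1 + of_nat r - of_nat r * w" by (simp add: algebra_simps)
    have "a * inverse b * (b * c / a) = c" if "a \<noteq> 0" "b \<noteq> 0" for a b c :: complex
      using that by simp
    from this[OF w] show ?case unfolding d * .
  qed
  from has_fps_expansion_cong[OF this refl] * show ?case by blast
qed

lemma du_fps_log_fps_nth_0: "fps_nth ((du_fps r ^^ Suc m) log_fps) 0 = xi_rat r m (-1)"
  using has_fps_expansion_imp_0_eq_fps_nth_0[OF has_fps_expansion_xi_rat[of r m]] by simp

lemma f_ser_eq:
  assumes r: "r \<ge> 1"
  shows "f_ser r m = (if m = 1 then fps_const (1 / of_nat r) else 0) - at_0 ((du_fps_h r ^^ m) (W_fps r))"
proof (rule fps_ext)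
  fix n
  have v: "fps_nth (at_0 ((du_fps_h r ^^ m) (W_fps r))) n
      = fps_nth (inverse S_fps) n * of_nat r ^ n * fps_nth ((du_fps r ^^ (m + n)) log_fps) 0"
    by (simp add: at_0_def du_fps_h_funpow_nth W_fps_def du_fps_funpow_const_mult funpow_add)
  show "fps_nth (f_ser r m) n = fps_nth ((if m = 1 then fps_const (1 / of_nat r) else 0)
      - at_0 ((du_fps_h r ^^ m) (W_fps r))) n"
  proof (cases "n = 0")
    case True
    show ?thesis
    proof (cases m)
      case 0
      then show ?thesis using True f_ser_nth_0(1)[OF r] v by (simp add: log_fps_def)
    next
      case (Suc j)
      then show ?thesis using True f_ser_nth_0(2)[OF r, of j] v du_fps_log_fps_nth_0[of j r]
        by (simp add: S_fps_nth_0)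
    qed
  next
    case False
    have c: "fps_nth (inverse S_fps) k = 0" if "odd k" for k
      using even_fps_inverse_S_fps that by (auto simp: even_fps_def)
    show ?thesis
    proof (cases "n = 1")
      case True
      then show ?thesis using f_ser_nth_1[OF r c[of 1]] v c[of 1] by simp
    next
      case n1: False
      then have n: "n \<ge> 2" using False by simp
      have "m + n = Suc (m + (n - 1))" using n by simp
      then have v': "fps_nth (at_0 ((du_fps_h r ^^ m) (W_fps r))) n
          = fps_nth (inverse S_fps) n * of_nat r ^ n * xi_rat r (m + (n - 1)) (-1)"
        unfolding v by (simp only: du_fps_log_fps_nth_0)
      show ?thesis
      proof (cases "odd n")
        case True
        then show ?thesis using False n f_ser_nth_ge_2[OF r n, of m] v' c by simp
      next
        \<comment> \<open>For even \<open>n\<close> the power \<open>(- r)^(n-1)\<close> is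
          \<open>- r^(n-1)\<close>; this is the minus sign in front of \<open>W\<close>.\<close>
        case e: False
        then have "odd (n - 1)" using n by simp
        then have "of_nat r * (- of_nat r) ^ (n - 1) = - (of_nat r * of_nat r ^ (n - 1) :: complex)"
          by (simp add: power_minus_odd)
        also have "of_nat r * of_nat r ^ (n - 1) = (of_nat r ^ n :: complex)"
          using n by (cases n) auto
        finally show ?thesis
          using False v' unfolding f_ser_nth_ge_2[OF r n] by (simp add: mult.assoc)
      qed
    qed
  qed
qed

section \<open>Logarithm and exponential over the ring of power series in \<hbar>\<close>

lemma fps_log_nth_0: "fps_nth (fps_log F) 0 = (0 :: 'a::{comm_ring_1,inverse})"
  by (simp add: fps_log_def)

lemma inverse_of_nat_complex_fps: "inverse (of_nat n :: complex fps) = fps_const (inverse (of_nat n))"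
  by (metis fps_const_inverse fps_of_nat)

lemma of_nat_mult_inverse_fps:
  assumes "of_nat n * inverse (of_nat n) = (1 :: 'a::{comm_ring_1,inverse})"
  shows "of_nat n * inverse (of_nat n) = (1 :: 'a fps)"
  by (rule fps_mult_inverse_eq_1) (use assms in \<open>simp flip: fps_of_nat\<close>)

lemma ring_map_inverse_of_nat:
  fixes f :: "'a::{comm_ring_1,inverse} \<Rightarrow> 'b::{comm_ring_1,inverse}"
  assumes f: "ring_map f" and "of_nat n * inverse (of_nat n) = (1 :: 'a)" and "of_nat n * inverse (of_nat n) = (1 :: 'b)"
  shows "f (inverse (of_nat n)) = inverse (of_nat n)"
proof (rule inverse_unique_comm_ring)
  have "f (of_nat n) = of_nat n" by (induction n) (auto simp: ring_mapD[OF f])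
  then show "of_nat n * f (inverse (of_nat n)) = 1" using assms(2) by (metis ring_mapD(1,3)[OF f])
qed (rule assms)

lemma fps_exp_1_fps: "fps_exp (1 :: complex fps) = Abs_fps (\<lambda>n. fps_const (1 / fact n))"
proof (rule fps_ext)
  fix n
  have "1 / of_nat (fact n) = (1 :: complex fps) * inverse (of_nat (fact n))"
    by (rule fps_divide_unit) (simp flip: fps_of_nat)
  then show "fps_nth (fps_exp (1 :: complex fps)) n = fps_nth (Abs_fps (\<lambda>n. fps_const (1 / fact n))) n"
    by (simp add: fps_exp_def inverse_of_nat_complex_fps inverse_eq_divide del: of_nat_fact) simp
qed

text \<open>\<^const>\<open>fps_exp\<close> has the expected derivative also over the coefficient ring \<open>complex fps\<close>,
  where the library lemma does not apply.\<close>

lemma fps_deriv_exp_compose: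
  fixes s :: "complex fps fps"
  assumes "fps_nth s 0 = 0"
  shows "fps_deriv (fps_exp 1 oo s) = (fps_exp 1 oo s) * fps_deriv s"
proof -
  have "fps_deriv (fps_exp (1 :: complex fps)) = fps_exp 1"
  proof (rule fps_ext)
    fix n
    have "fps_nth (fps_deriv (fps_exp (1 :: complex fps))) n = fps_const (of_nat (Suc n) * (1 / fact (Suc n)))"
      by (simp only: fps_exp_1_fps fps_deriv_nth fps_nth_Abs_fps Suc_eq_plus1 fps_const_mult flip: fps_of_nat)
    also have "of_nat (Suc n) * (1 / fact (Suc n)) = (1 / fact n :: complex)"
      by (simp del: of_nat_Suc)
    finally show "fps_nth (fps_deriv (fps_exp (1 :: complex fps))) n = fps_nth (fps_exp 1) n"
      by (simp add: fps_exp_1_fps)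
  qed
  then show ?thesis by (subst fps_compose_deriv[OF assms]) simp
qed

text \<open>Differentiating in \<open>t\<close> shows that \<open>exp (- log Y) * Y\<close> is
  constant, hence 1. Conversely, a solution \<open>s\<close> has the same derivative as
  \<open>log Y\<close> after cancelling \<open>H\<close> in an integral domain. The equivalence lets
  the description defining \<open>sstar_series\<close> be rewritten directly.\<close>

lemma exp_neg_eq_iff_fps_log:
  fixes s Y H :: "complex fps fps"
  assumes YH: "Y * H = 1" and Y: "fps_nth Y 0 = 1"
  shows "fps_nth s 0 = 0 \<and> fps_exp 1 oo (- s) = H \<longleftrightarrow> s = fps_log Y"
proof -
  let ?E = "\<lambda>s. fps_exp 1 oo (- s) :: complex fps fps"
  have E': "fps_deriv (?E s) = - (?E s * fps_deriv s)" if "fps_nth s 0 = 0" for s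
    using that by (subst fps_deriv_exp_compose) auto
  have E0: "fps_nth (?E s) 0 = 1" for s by (simp add: fps_exp_1_fps)
  have L: "fps_deriv (fps_log Y) * Y = fps_deriv Y"
    by (rule fps_deriv_fps_log[OF of_nat_mult_inverse_fps Y]) simp
  have L0: "fps_nth (fps_log Y) 0 = 0" by (rule fps_log_nth_0)
  have "fps_deriv (?E (fps_log Y) * Y) = ?E (fps_log Y) * (fps_deriv Y - fps_deriv (fps_log Y) * Y)"
    by (simp add: E'[OF L0] algebra_simps)
  then have "fps_deriv (?E (fps_log Y) * Y) = 0" using L by simp
  then have "?E (fps_log Y) * Y = fps_const (fps_nth (?E (fps_log Y) * Y) 0)"
    by (simp only: fps_deriv_eq_0_iff)
  then have "Y * ?E (fps_log Y) = 1" using Y E0 by (simp add: mult.commute)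
  then have EL: "?E (fps_log Y) = H" using YH by (rule inverse_unique_comm_ring)
  moreover have "s = fps_log Y" if s: "fps_nth s 0 = 0" "?E s = H"
  proof -
    have "H * fps_deriv s = H * fps_deriv (fps_log Y)"
      using E'[OF s(1)] E'[OF L0] s(2) EL by (metis neg_equal_iff_equal)
    moreover have "H \<noteq> 0" using YH by auto
    ultimately have "fps_deriv s = fps_deriv (fps_log Y)" by simp
    then show ?thesis using s(1) L0 by (simp add: fps_deriv_eq_iff)
  qed
  ultimately show ?thesis using L0 by blast
qed

lemma sums_fps_single: "(\<lambda>m. if m = k then f m else 0) sums (f k :: 'a::ab_group_add fps)"
  unfolding fps_sums_iff
proof
  fix n
  have "\<forall>\<^sub>F M in sequentially. M > k" by (rule eventually_gt_at_top)
  then show "\<forall>\<^sub>F M in sequentially. (\<Sum>m<M. fps_nth (if m = k then f m else 0) n) = fps_nth (f k) n"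
    by eventually_elim (simp add: if_distrib[of "\<lambda>x. fps_nth x n"] cong: if_cong)
qed

section \<open>The starred series as values at the root of \<open>W\<close>\<close>

context
  fixes r :: nat
  assumes r: "r \<ge> 1"
begin

lemma W_fps_nth_0: "fps_nth (W_fps r) 0 = log_fps"
  by (simp add: W_fps_def S_fps_nth_0)

lemma W_fps_simple_zero: "fps_nth (fps_nth (W_fps r) 0) 0 = 0" "fps_nth (fps_nth (W_fps r) 0) 1 \<noteq> 0"
proof -
  show "fps_nth (fps_nth (W_fps r) 0) 0 = 0" by (simp add: W_fps_nth_0 log_fps_def)
  have "fps_nth (fps_deriv log_fps) 0 = -1" by (simp only: fps_deriv_log_fps) simp
  then show "fps_nth (fps_nth (W_fps r) 0) 1 \<noteq> 0" by (simp add: W_fps_nth_0)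
qed

abbreviation ev :: "complex fps fps \<Rightarrow> complex fps" where
  "ev \<equiv> root_eval (W_fps r)"

abbreviation u_root :: "complex fps" where
  "u_root \<equiv> ev (fps_const (u_fps r))"

lemma ev_eq: "ev g = res_w (fps_map fps_to_fls g * dlog (W_ser r))"
  by (simp add: root_eval_def W_ser_eq)

lemmas ring_map_ev = ring_map_root_eval[OF W_fps_simple_zero]
lemmas ev_nth_0 = root_eval_nth_0[OF W_fps_simple_zero]

lemma even_fps_u_root: "even_fps u_root"
proof -
  have W: "even_fps (W_fps r)"
    using even_fps_inverse_S_fps by (simp add: even_fps_def W_fps_def)
  then have "even_fps (fps_map fps_to_fls (W_fps r))" by (rule even_fps_map) simp
  moreover have "fps_nth (fps_map fps_to_fls (W_fps r)) 0 \<noteq> 0" using W_fps_simple_zero by auto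
  ultimately have "even_fps (dlog (fps_map fps_to_fls (W_fps r)))"
    unfolding dlog_def by (intro even_fps_mult even_fps_map even_fps_inverse W) auto
  then show ?thesis unfolding root_eval_def res_w_def
    by (intro even_fps_map even_fps_mult even_fps_const) auto
qed

text \<open>Taylor expansion of \<open>\<partial>\<^sub>u\<^sup>k W\<close> at the root. The term C
  of \<open>f_ser r (k + m)\<close> occurs only for \<open>k + m = 1\<close>, which gives C times
  the root for \<open>k = 0\<close> and C for \<open>k = 1\<close>.\<close>

lemma f_ser_sums:
  "(\<lambda>m. f_ser r (k + m) * u_root ^ m * fps_const (1 / fact m)) sums
    ((if k = 0 then fps_const (1 / of_nat r) * u_root else if k = 1 then fps_const (1 / of_nat r) else 0)
      - ev ((du_fps_h r ^^ k) (W_fps r)))"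
proof -
  let ?C = "fps_const (1 / of_nat r) :: complex fps"
  let ?s = "\<lambda>m. if k + m = 1 then ?C * u_root ^ m else 0"
  have "?s sums (if k = 0 then ?C * u_root else if k = 1 then ?C else 0)"
  proof -
    consider "k = 0" | "k = 1" | "k \<ge> 2" by linarith
    then show ?thesis
    proof cases
      case 1
      with sums_fps_single[of 1 "\<lambda>m. ?C * u_root ^ m"] show ?thesis by simp
    next
      case 2
      with sums_fps_single[of 0 "\<lambda>m. ?C * u_root ^ m"] show ?thesis by simp
    qed (simp add: sums_zero)
  qed
  from fps_sums_diff[OF this root_eval_taylor[OF W_fps_simple_zero, of r "(du_fps_h r ^^ k) (W_fps r)"]]
  show ?thesis
  proof (rule sums_cong[THEN iffD1, rotated])
    fix m
    have v: "(du_fps_h r ^^ m) ((du_fps_h r ^^ k) (W_fps r)) = (du_fps_h r ^^ (k + m)) (W_fps r)"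
      by (metis add.commute funpow_add comp_apply)
    have "fact m = (1 :: complex)" if "k + m = 1" using that by (cases m) auto
    then show "?s m - at_0 ((du_fps_h r ^^ m) ((du_fps_h r ^^ k) (W_fps r))) * u_root ^ m * fps_const (1 / fact m)
        = f_ser r (k + m) * u_root ^ m * fps_const (1 / fact m)"
      unfolding v f_ser_eq[OF r] by (simp add: left_diff_distrib)
  qed
qed

lemma ustar_eq: "ustar r = u_root"
  unfolding ustar_def
proof (rule the_equality)
  let ?C = "fps_const (1 / of_nat r) :: complex fps"
  have U0: "fps_nth u_root 0 = 0" by (simp add: ev_nth_0)
  have evW: "ev (W_fps r) = 0" using root_eval_W_mult[OF W_fps_simple_zero, of 1] by simp
  have U: "(\<lambda>m. f_ser r m * u_root ^ m * fps_const (1 / fact m)) sums (?C * u_root)"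
    using f_ser_sums[of 0] by (simp add: evW)
  show "(\<forall>n. odd n \<longrightarrow> fps_nth u_root n = 0) \<and> fps_nth u_root 0 = 0 \<and>
      (\<lambda>m. f_ser r m * u_root ^ m * fps_const (1 / fact m)) sums (?C * u_root)"
    using even_fps_u_root U0 U by (auto simp: even_fps_def)
  fix u :: "complex fps"
  assume "(\<forall>n. odd n \<longrightarrow> fps_nth u n = 0) \<and> fps_nth u 0 = 0 \<and>
      (\<lambda>m. f_ser r m * u ^ m * fps_const (1 / fact m)) sums (?C * u)"
  then have u0: "fps_nth u 0 = 0" and u: "(\<lambda>m. f_ser r m * u ^ m * fps_const (1 / fact m)) sums (?C * u)"
    by auto
  show "u = u_root"
  proof (rule ccontr)
    assume "u \<noteq> u_root"
    then have nz: "u - u_root \<noteq> 0" by simp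
    \<comment> \<open>Uniqueness: two solutions are compared at the lowest order \<open>d\<close> in
      which they differ.\<close>
    define d where "d = subdegree (u - u_root)"
    define D where "D = fps_shift d (u - u_root)"
    have uD: "u - u_root = fps_X ^ d * D" unfolding D_def d_def by (metis mult.commute subdegree_decompose)
    have D0: "fps_nth D 0 \<noteq> 0" using nth_subdegree_nonzero[OF nz]
      by (simp only: D_def d_def fps_shift_nth add_0 not_False_eq_True)
    define v where "v = (\<lambda>m. at_0 ((du_fps_h r ^^ m) (W_fps r)))"
    \<comment> \<open>The term at \<open>m = 1\<close> moves the difference of the right-hand sides
      into the sum, where it cancels the C in \<open>f_ser r 1\<close>.\<close>
    let ?t = "\<lambda>m. f_ser r m * u ^ m * fps_const (1 / fact m) - f_ser r m * u_root ^ m * fps_const (1 / fact m)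
      - (if m = 1 then ?C * u - ?C * u_root else 0)"
    have "?t sums ((?C * u - ?C * u_root) - (?C * u - ?C * u_root))"
      by (rule fps_sums_diff[OF fps_sums_diff[OF u U] sums_fps_single])
    then have "\<forall>\<^sub>F M in sequentially. (\<Sum>m<M. fps_nth (?t m) d) = 0"
      by (simp add: fps_sums_iff)
    then have "\<forall>\<^sub>F M in sequentially. (\<Sum>m<M. fps_nth (?t m) d) = 0 \<and> 1 < M"
      by (intro eventually_conj eventually_gt_at_top)
    then obtain M where M: "(\<Sum>m<M. fps_nth (?t m) d) = 0" "1 < M"
      using eventually_happens'[OF sequentially_bot] by blast
    have t: "fps_nth (?t m) d = (if m = 1 then - (fps_nth (v 1) 0 * fps_nth D 0) else 0)" for m
    proof -
      have t: "?t m = - (v m * (u ^ m - u_root ^ m) * fps_const (1 / fact m))"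
        unfolding f_ser_eq[OF r] v_def by (cases "m = 1") (simp_all add: algebra_simps)
      consider "m = 0" | "m = 1" | "m \<ge> 2" by linarith
      then show ?thesis
      proof cases
        case 2
        then have "?t m = fps_X ^ d * (- (v 1 * D))" unfolding t by (simp add: uD mult_ac)
        then show ?thesis using 2 by (simp only: fps_X_power_mult_nth) simp
      next
        case 3
        define S where "S = (\<Sum>i<m. u_root ^ (m - Suc i) * u ^ i)"
        \<comment> \<open>For \<open>m \<ge> 2\<close> the cofactor of \<open>u - u_root\<close> in
          the difference of \<open>m\<close>-th powers vanishes at \<hbar> = 0, so only the linear
          term reaches order \<open>d\<close>.\<close>
        have S0: "fps_nth S 0 = 0" unfolding S_def fps_sum_nth
        proof (intro sum.neutral ballI)
          fix i assume "i \<in> {..<m}"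
          then have "m - Suc i \<noteq> 0 \<or> i \<noteq> 0" using 3 by auto
          then show "fps_nth (u_root ^ (m - Suc i) * u ^ i) 0 = 0"
            by (auto simp: fps_power_zeroth u0 U0 power_0_left)
        qed
        have "?t m = fps_X ^ d * (- (v m * D * S * fps_const (1 / fact m)))"
          unfolding t power_diff_sumr2 uD S_def by (simp add: mult_ac)
        then show ?thesis using 3 S0 by (simp only: fps_X_power_mult_nth) simp
      qed (simp add: t)
    qed
    have "(\<Sum>m<M. fps_nth (?t m) d) = (\<Sum>m<M. if m = 1 then - (fps_nth (v 1) 0 * fps_nth D 0) else 0)"
      by (simp only: t)
    also have "\<dots> = - (fps_nth (v 1) 0 * fps_nth D 0)" using M(2) by simp
    finally have "fps_nth (v 1) 0 * fps_nth D 0 = 0" using M(1) by simp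
    moreover have "fps_nth (v 1) 0 = 1 / (1 + of_nat r)"
      using du_fps_log_fps_nth_0[of 0 r]
      by (simp add: v_def at_0_def W_fps_nth_0 xi_rat_def)
    ultimately show False using D0 one_plus_of_nat_nonzero[of r] by simp
  qed
qed

lemma fstar_eq:
  assumes "k \<ge> 1"
  shows "fstar r k = (if k = 1 then fps_const (1 / of_nat r) else 0) - ev ((du_fps_h r ^^ k) (W_fps r))"
  unfolding fstar_def ustar_eq using f_ser_sums[of k] assms by (auto dest!: sums_unique)

lemma Cstar_eq: "Cstar r = ev (du_fps_h r (W_fps r))"
  by (simp add: Cstar_def fstar_eq)

lemma sstar_eq:
  assumes "k \<ge> 1"
  shows "sstar r k = res_w (fps_nth (fps_log (fps_const (d_du_h r (W_ser r)) * inverse (d_du_geometric r (W_ser r)))) k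
                  * dlog (W_ser r))"
proof -
  define G where "G = Abs_fps (\<lambda>i. (du_fps_h r ^^ (i + 1)) (W_fps r))"
  define G0 where "G0 = du_fps_h r (W_fps r)"
  define F where "F = fps_const G0 * inverse G"
  let ?i = "fps_map fps_to_fls :: complex fps fps \<Rightarrow> complex fls fps"
  have i: "ring_map ?i" by (rule ring_map_fps_map[OF ring_map_fps_to_fls])
  note hi = ring_mapD[OF ring_map_fps_map[OF i]] and he = ring_mapD[OF ring_map_fps_map[OF ring_map_ev]]
  have GG0: "fps_nth G 0 = G0" by (simp add: G_def G0_def)
  have G00: "fps_nth G0 0 = inverse (1 + of_nat r - of_nat r * fps_X)"
    by (simp add: G0_def W_fps_nth_0 du_log_fps)
  have "fps_nth (fps_nth G0 0) 0 \<noteq> 0" unfolding G00 using one_plus_of_nat_nonzero by simp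
  then have "fps_nth G0 0 * inverse (fps_nth G0 0) = 1" (is ?inv) and evG0: "fps_nth (ev G0) 0 \<noteq> 0"
    by (rule inverse_mult_eq_1') (simp add: ev_nth_0 \<open>fps_nth (fps_nth G0 0) 0 \<noteq> 0\<close>)
  from \<open>?inv\<close> have invG0: "G0 * inverse G0 = 1" by (rule fps_mult_inverse_eq_1)
  then have invG: "G * inverse G = 1" by (intro fps_mult_inverse_eq_1[of G]) (simp add: GG0)
  \<comment> \<open>The inverse in the statement is taken over Laurent series in \<open>w\<close>.
    It agrees with the one over power series, because \<open>G0\<close> is already a unit there: its
    constant term is \<open>1 / (1 + r)\<close>.\<close>
  have "?i G0 * inverse (?i G0) = 1"
    using \<open>fps_nth (fps_nth G0 0) 0 \<noteq> 0\<close> by (intro inverse_mult_eq_1') auto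
  then have "fps_map ?i (inverse G) = inverse (fps_map ?i G)"
    using invG0 by (intro fps_map_inverse[OF i]) (auto simp: GG0)
  moreover have "d_du_geometric r (W_ser r) = fps_map ?i G"
    by (rule fps_ext) (simp add: d_du_geometric_def G_def W_ser_eq d_du_h_funpow_fps_to_fls d_du_h_fps_to_fls)
  moreover have "fps_const (d_du_h r (W_ser r)) = fps_map ?i (fps_const G0)"
    by (simp add: fps_map_fps_const[OF i] G0_def W_ser_eq d_du_h_fps_to_fls)
  ultimately have iF: "fps_const (d_du_h r (W_ser r)) * inverse (d_du_geometric r (W_ser r)) = fps_map ?i F"
    by (simp add: F_def hi)
  have inv_i: "?i (inverse (of_nat n)) = inverse (of_nat n)" if "n \<noteq> 0" for n
    using that by (intro ring_map_inverse_of_nat[OF i] of_nat_mult_inverse_fps) auto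
  have inv_e: "ev (inverse (of_nat n)) = inverse (of_nat n)" if "n \<noteq> 0" for n
    using that by (intro ring_map_inverse_of_nat[OF ring_map_ev] of_nat_mult_inverse_fps) auto
  have "res_w (fps_nth (fps_log (fps_map ?i F)) k * dlog (W_ser r)) = ev (fps_nth (fps_log F) k)"
    by (simp add: ev_eq flip: fps_map_fps_log[OF i inv_i])
  also have "\<dots> = fps_nth (fps_log (fps_map ev F)) k"
    by (simp flip: fps_map_fps_log[OF ring_map_ev inv_e])
  also have "\<dots> = sstar r k"
  proof -
    \<comment> \<open>Coefficient \<open>i\<close> of \<open>G\<close> is
      \<open>\<partial>\<^sub>u\<close> applied \<open>i + 1\<close> times to \<open>W\<close>, so
      its value is \<open>Cstar r\<close> for \<open>i = 0\<close> and
      \<open>- fstar r (i + 1)\<close> for \<open>i \<ge> 1\<close>. Dividing by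
      \<open>Cstar r\<close> gives the right-hand side of the equation for
      \<open>sstar_series\<close>.\<close>
    define H where "H = fps_map ev G * fps_const (inverse (ev G0))"
    have invE: "ev G0 * inverse (ev G0) = 1" using evG0 by (rule inverse_mult_eq_1')
    have eF: "fps_map ev F * fps_map ev G = fps_const (ev G0)"
    proof -
      have "F * G = fps_const G0" using invG by (simp add: F_def mult_ac)
      then show ?thesis by (metis he(3) fps_map_fps_const[OF ring_map_ev])
    qed
    have FH: "fps_map ev F * H = 1"
      using eF invE by (simp add: H_def flip: mult.assoc)
    have "fps_nth (fps_map ev F) 0 * ev G0 = ev G0"
      using arg_cong[OF eF, of "\<lambda>x. fps_nth x 0"] by (simp add: GG0)
    moreover have "ev G0 \<noteq> 0" using evG0 by auto
    ultimately have F0: "fps_nth (fps_map ev F) 0 = 1" by simp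
    have "1 - Abs_fps (\<lambda>k. if k = 0 then 0 else fstar r (k + 1) * inverse (fps_const (1 / of_nat r) - fstar r 1)) = H"
    proof (rule fps_ext)
      fix n
      have "fps_const (1 / of_nat r) - fstar r 1 = ev G0" using Cstar_eq by (simp add: Cstar_def G0_def)
      then show "fps_nth (1 - Abs_fps (\<lambda>k. if k = 0 then 0 else fstar r (k + 1)
          * inverse (fps_const (1 / of_nat r) - fstar r 1))) n = fps_nth H n"
        using invE GG0 by (cases n) (simp_all add: H_def fstar_eq G_def)
    qed
    then have "sstar_series r = (THE s. s = fps_log (fps_map ev F))"
      unfolding sstar_series_def by (simp only: exp_neg_eq_iff_fps_log[OF FH F0])
    then show ?thesis by (simp add: sstar_def)
  qed
  finally show ?thesis unfolding iF by simp
qed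

end

theorem proposition4p7:
  fixes r :: nat
  assumes "r \<ge> 1"
  shows "ustar r = res_w (fps_const (u_w r) * dlog (W_ser r)) \<and>
         Cstar r = res_w (d_du_h r (W_ser r) * dlog (W_ser r)) \<and>
         (\<forall>k\<ge>1. sstar r k =
           res_w (fps_nth (fps_log (fps_const (d_du_h r (W_ser r)) * inverse (d_du_geometric r (W_ser r)))) k
                  * dlog (W_ser r)))"
proof (intro conjI allI impI)
  show "ustar r = res_w (fps_const (u_w r) * dlog (W_ser r))"
    unfolding ustar_eq[OF assms] ev_eq[OF assms] u_w_eq by (simp add: fps_map_fps_const[OF ring_map_fps_to_fls])
  show "Cstar r = res_w (d_du_h r (W_ser r) * dlog (W_ser r))"
    unfolding Cstar_eq[OF assms] ev_eq[OF assms] W_ser_eq d_du_h_fps_to_fls ..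
qed (rule sstar_eq[OF assms])

end
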